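(* Let $\Omega\subseteq\mathbb{R}^n$ be open and let $w:\mathbb{R}^n\to(0,\infty]$ be lower semicontinuous. (i) $f\in BV(\Omega;w)$ if and only if $f\in BV_{\mathrm{loc}}(\Omega)$ and $w\in L^1(\Omega;d\lVert Df\rVert)$. In this case, $$\lVert Df\rVert_w(\Omega)=\int_\Omega w\,d\lVert Df\rVert.$$ (ii) $f\in BV_{\mathrm{loc}}(\Omega;w)$ if and only if $f\in BV_{\mathrm{loc}}(\Omega)$ and $w\in L^1_{\mathrm{loc}}(\Omega;d\lVert Df\rVert)$. In this case, $$\lVert Df\rVert_w(V)=\int_V w\,d\lVert Df\rVert\quad\text{for all }V\Subset\Omega.$$ (iii) Suppose $w\ge c>0$ on $\Omega$. Then $f\in BV(\Omega;w)$ if and only if $f\in BV(\Omega)$ and $w\in L^1(\Omega;d\lVert Df\rVert)$. In this case, $$\lVert Df\rVert_w(\Omega)=\int_\Omega w\,d\lVert Df\rVert.$$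
   Context: $\mathrm{Lip}_c(V;\mathbb{R}^n)$ is the space of compactly supported Lipschitz maps from $V$ to $\mathbb{R}^n$; $V\Subset\Omega$ means $V$ is open with compact closure in $\Omega$; $c$ is a constant. $L^1(\Omega;w)$ (resp. $L^1_{\mathrm{loc}}(\Omega;w)$) is the space of measurable $f$ with $\int_\Omega|f|\,w\,dx<\infty$ (resp. $\int_K|f|\,w\,dx<\infty$ for all compact $K\subseteq\Omega$). For open $V\subseteq\Omega$, $$\lVert Df\rVert_w(V):=\sup\left\{\int_V f\operatorname{div}\varphi\,dx:\varphi\in\mathrm{Lip}_c(V;\mathbb{R}^n),\ |\varphi|\le w\right\}.$$ $BV(\Omega;w)$ is the space of $f\in L^1(\Omega;w)$ with $\lVert Df\rVert_w(\Omega)<\infty$; $BV_{\mathrm{loc}}(\Omega;w)$ is the space of $f\in L^1_{\mathrm{loc}}(\Omega;w)$ with $\lVert Df\rVert_w(V)<\infty$ for all $V\Subset\Omega$. Functions agreeing a.e. are identified. $BV(\Omega)$ and $BV_{\mathrm{loc}}(\Omega)$ are the classical spaces, i.e. the case $w\equiv1$. For $f\in BV_{\mathrm{loc}}(\Omega)$, $\lVert Df\rVert$ denotes the classical (unweighted) total variation Radon measure of $f$ on $\Omega$.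
   Formalization: Each equivalence is stated for f in L^1(Ω;w) in (i), (iii), or L^1_loc(Ω;w) in (ii), since the right-hand side does not imply this (e.g. f=1, w=1, Ω=R^n has Df=0 but f not in L^1); the integral formulas need no such assumption. *)

theory Defs
  imports "HOL-Analysis.Analysis"
begin

text \<open>
  The ambient space \<open>\<real>\<^sup>n\<close> is an arbitrary type of class \<open>euclidean_space\<close>.  A weight is a
  function \<open>w :: 'a \<Rightarrow> ennreal\<close>, so that the value \<open>\<infinity>\<close> is allowed.  A function \<open>f\<close> on an open
  set \<open>\<Omega>\<close> is a total function \<open>'a \<Rightarrow> real\<close> of which only the values on \<open>\<Omega>\<close> are used; instead of
  a.e. equivalence classes the spaces below consist of all representatives.  In weighted
  integrals the convention \<open>0 * \<infinity> = 0\<close> of \<open>ennreal\<close> applies.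
\<close>

definition lower_semicontinuous :: "('a::topological_space \<Rightarrow> 'b::linorder) \<Rightarrow> bool" where
  "lower_semicontinuous w \<longleftrightarrow> (\<forall>x. \<forall>t < w x. \<forall>\<^sub>F y in nhds x. t < w y)"

definition compactly_contained :: "'a::topological_space set \<Rightarrow> 'a set \<Rightarrow> bool" (infix "\<Subset>" 50)
  where "V \<Subset> \<Omega> \<longleftrightarrow> open V \<and> compact (closure V) \<and> closure V \<subseteq> \<Omega>"

text \<open>Only the restriction of a vector field to \<open>V\<close> matters; its support must be a compact
  subset of the open set \<open>V\<close>.\<close>

definition Lip_c :: "'a::euclidean_space set \<Rightarrow> ('a \<Rightarrow> 'a) set" where
  "Lip_c V = {\<phi>. (\<exists>C. C-lipschitz_on V \<phi>) \<and>
     compact (closure {x \<in> V. \<phi> x \<noteq> 0}) \<and> closure {x \<in> V. \<phi> x \<noteq> 0} \<subseteq> V}"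

text \<open>The sum of the partial derivatives \<open>\<partial>\<^sub>b \<phi>\<^sub>b\<close>.  For Lipschitz fields these exist almost
  everywhere; on the remaining null set the value is irrelevant.\<close>

definition divergence :: "('a::euclidean_space \<Rightarrow> 'a) \<Rightarrow> 'a \<Rightarrow> real" where
  "divergence \<phi> x = (\<Sum>b\<in>Basis. deriv (\<lambda>t. \<phi> (x + t *\<^sub>R b) \<bullet> b) 0)"

text \<open>The field \<open>\<phi> = 0\<close> is always admissible, so sending negative integrals to \<open>0\<close> by the
  coercion \<open>ennreal\<close> does not change the supremum.\<close>

definition weighted_variation ::
    "('a::euclidean_space \<Rightarrow> ennreal) \<Rightarrow> ('a \<Rightarrow> real) \<Rightarrow> 'a set \<Rightarrow> ennreal" where
  "weighted_variation w f V =
     (SUP \<phi> \<in> {\<phi> \<in> Lip_c V. \<forall>x\<in>V. ennreal (norm (\<phi> x)) \<le> w x}.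
        ennreal (LINT x:V|lebesgue. f x * divergence \<phi> x))"

definition L1_weighted :: "'a::euclidean_space set \<Rightarrow> ('a \<Rightarrow> ennreal) \<Rightarrow> ('a \<Rightarrow> real) set" where
  "L1_weighted \<Omega> w = {f. f \<in> borel_measurable (lebesgue_on \<Omega>) \<and>
     (\<integral>\<^sup>+x\<in>\<Omega>. ennreal \<bar>f x\<bar> * w x \<partial>lebesgue) < \<infinity>}"

definition L1_loc_weighted :: "'a::euclidean_space set \<Rightarrow> ('a \<Rightarrow> ennreal) \<Rightarrow> ('a \<Rightarrow> real) set" where
  "L1_loc_weighted \<Omega> w = {f. f \<in> borel_measurable (lebesgue_on \<Omega>) \<and>
     (\<forall>K. compact K \<and> K \<subseteq> \<Omega> \<longrightarrow> (\<integral>\<^sup>+x\<in>K. ennreal \<bar>f x\<bar> * w x \<partial>lebesgue) < \<infinity>)}"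

definition BV_weighted :: "'a::euclidean_space set \<Rightarrow> ('a \<Rightarrow> ennreal) \<Rightarrow> ('a \<Rightarrow> real) set" where
  "BV_weighted \<Omega> w = {f \<in> L1_weighted \<Omega> w. weighted_variation w f \<Omega> < \<infinity>}"

definition BV_loc_weighted :: "'a::euclidean_space set \<Rightarrow> ('a \<Rightarrow> ennreal) \<Rightarrow> ('a \<Rightarrow> real) set" where
  "BV_loc_weighted \<Omega> w =
     {f \<in> L1_loc_weighted \<Omega> w. \<forall>V. V \<Subset> \<Omega> \<longrightarrow> weighted_variation w f V < \<infinity>}"

abbreviation BV :: "'a::euclidean_space set \<Rightarrow> ('a \<Rightarrow> real) set" where
  "BV \<Omega> \<equiv> BV_weighted \<Omega> (\<lambda>_. 1)"

abbreviation BV_loc :: "'a::euclidean_space set \<Rightarrow> ('a \<Rightarrow> real) set" where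
  "BV_loc \<Omega> \<equiv> BV_loc_weighted \<Omega> (\<lambda>_. 1)"

text \<open>The classical total variation measure \<open>\<parallel>Df\<parallel>\<close> on the Borel subsets of \<open>\<Omega>\<close>: on open sets it
  is the variation with \<open>w = 1\<close>, extended to Borel sets by outer regularity.  For
  \<open>f \<in> BV_loc \<Omega>\<close> this set function is countably additive, by the structure theorem for
  \<open>BV_loc\<close> functions; when it is not, \<open>measure_of\<close> yields the zero measure.\<close>

definition variation_measure :: "'a::euclidean_space set \<Rightarrow> ('a \<Rightarrow> real) \<Rightarrow> 'a measure" where
  "variation_measure \<Omega> f = measure_of \<Omega> {A \<in> sets borel. A \<subseteq> \<Omega>}
     (\<lambda>A. INF V \<in> {V. open V \<and> A \<subseteq> V \<and> V \<subseteq> \<Omega>}. weighted_variation (\<lambda>_. 1) f V)"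

text \<open>\<open>L\<^sup>1(\<Omega>; d\<mu>)\<close> and \<open>L\<^sup>1\<^sub>l\<^sub>o\<^sub>c(\<Omega>; d\<mu>)\<close> for functions with values in \<open>[0, \<infinity>]\<close> and a measure
  \<open>\<mu>\<close> on \<open>\<Omega>\<close>.\<close>

definition L1_measure :: "'a::euclidean_space set \<Rightarrow> 'a measure \<Rightarrow> ('a \<Rightarrow> ennreal) set" where
  "L1_measure \<Omega> \<mu> = {w \<in> borel_measurable \<mu>. (\<integral>\<^sup>+x\<in>\<Omega>. w x \<partial>\<mu>) < \<infinity>}"

definition L1_loc_measure :: "'a::euclidean_space set \<Rightarrow> 'a measure \<Rightarrow> ('a \<Rightarrow> ennreal) set" where
  "L1_loc_measure \<Omega> \<mu> = {w \<in> borel_measurable \<mu>.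
     \<forall>K. compact K \<and> K \<subseteq> \<Omega> \<longrightarrow> (\<integral>\<^sup>+x\<in>K. w x \<partial>\<mu>) < \<infinity>}"

end

theory Submission
  imports Defs
begin

text \<open>
  Write \<open>\<mu>\<close> for the classical variation measure of \<open>f\<close> and \<open>L \<phi>\<close> for \<open>\<integral> f div \<phi>\<close>.  Everything
  reduces to the identity \<open>sup {L \<phi> | \<phi> \<in> Lip_c V, |\<phi>| \<le> w} = \<integral>\<^sub>V w d\<mu>\<close> for open \<open>V \<subseteq> \<Omega>\<close>, valid for
  every \<open>f \<in> BV_loc \<Omega>\<close> even if both sides are infinite (\<open>weighted_variation_eq_nn_integral\<close>).
  Both inequalities are layer-cake arguments: the weight, or the length of a field, is sliced along
  its superlevel sets, which are open, and on an open set \<open>\<mu>\<close> is a supremum over fields by definition.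

  Lower bound.  If \<open>|\<phi>| \<le> u\<close> and \<open>|\<psi>| \<le> v\<close> then \<open>|\<phi> + \<psi>| \<le> u + v\<close>, so the weighted variation is
  superadditive in the weight; for the weight \<open>c 1\<^sub>U\<close> with \<open>U\<close> open it is at least \<open>c \<mu>(U)\<close>.  Lower
  semicontinuity makes \<open>{w > t}\<close> open, hence \<open>\<epsilon> \<Sum>\<^sub>k 1\<^bsub>{w > k \<epsilon>}\<^esub> \<le> w\<close> is a sum of such weights, and
  these staircases converge to \<open>w\<close> (\<open>nn_integral_le_weighted_variation\<close>).

  Upper bound.  Radial projection onto balls of radius \<open>j \<epsilon>\<close> cuts a field \<open>\<phi>\<close> into shells \<open>\<phi>\<^sub>j\<close> with
  \<open>|\<phi>\<^sub>j| \<le> \<epsilon>\<close>, each vanishing where \<open>|\<phi>| \<le> j \<epsilon>\<close>.  Then \<open>L \<phi>\<^sub>j \<le> \<epsilon> \<mu>{|\<phi>| > (j - 1) \<epsilon>}\<close>, and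
  summation over \<open>j\<close> gives \<open>L \<phi> \<le> \<integral> |\<phi>| d\<mu> + O(\<epsilon>)\<close> (\<open>pairing_le_nn_integral_norm\<close>).

  Two prerequisites carry most of the work.  First, \<open>L\<close> has to be linear on Lipschitz fields, which
  requires their partial derivatives to exist almost everywhere: on the exceptional set \<open>deriv\<close> is an
  arbitrary value that does not respect sums.  This is obtained from a one-dimensional Vitali covering
  argument (\<open>null_oscillating_slopes\<close>) and Tonelli's theorem (\<open>AE_partial_derivative_exists\<close>).
  Second, \<open>variation_measure\<close> has to be the Caratheodory measure with the prescribed values on
  open sets (\<open>emeasure_variation_measure_open\<close>).

  The membership statements follow from the identity, because a positive lower semicontinuous weight
  is bounded away from \<open>0\<close> on compact sets.
\<close>

section \<open>Differentiability of Lipschitz functions on the line\<close>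

text \<open>Difference quotients are taken over intervals \<open>(t + a, t + b)\<close> that straddle \<open>t\<close>, with strict
  inequalities throughout: for continuous \<open>g\<close> this makes the sets of such \<open>t\<close> countable
  intersections of open sets, hence Borel.\<close>

definition slopes_below :: "(real \<Rightarrow> real) \<Rightarrow> real \<Rightarrow> real \<Rightarrow> bool" where
  "slopes_below g p t \<longleftrightarrow>
     (\<forall>d>0. \<exists>a<0. \<exists>b>0. b - a < d \<and> g (t + b) - g (t + a) < p * (b - a))"

definition slopes_above :: "(real \<Rightarrow> real) \<Rightarrow> real \<Rightarrow> real \<Rightarrow> bool" where
  "slopes_above g q t \<longleftrightarrow>
     (\<forall>d>0. \<exists>a<0. \<exists>b>0. b - a < d \<and> q * (b - a) < g (t + b) - g (t + a))"

lemma mono_image_Icc_subset: "mono (F::real\<Rightarrow>real) \<Longrightarrow> F ` {a..b} \<subseteq> {F a..F b}"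
  by (auto simp: mono_def)

lemma emeasure_UN_le_nn_integral:
  assumes "countable D" and A: "\<And>i. i \<in> D \<Longrightarrow> A i \<in> sets M"
  shows "emeasure M (\<Union>i\<in>D. A i) \<le> (\<integral>\<^sup>+i. emeasure M (A i) \<partial>count_space D)"
proof -
  have "emeasure M (\<Union>i\<in>D. A i) = (\<integral>\<^sup>+x. indicator (\<Union>i\<in>D. A i) x \<partial>M)"
    using assms by (intro nn_integral_indicator[symmetric] sets.countable_UN') auto
  also have "\<dots> \<le> (\<integral>\<^sup>+x. \<integral>\<^sup>+i. indicator (A i) x \<partial>count_space D \<partial>M)"
  proof (rule nn_integral_mono)
    fix x
    show "indicator (\<Union>i\<in>D. A i) x \<le> (\<integral>\<^sup>+i. indicator (A i) x \<partial>count_space D)"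
    proof (cases "x \<in> (\<Union>i\<in>D. A i)")
      case True
      then obtain j where "j \<in> D" "x \<in> A j" by blast
      then show ?thesis
        using nn_integral_ge_point[of j D "\<lambda>i. indicator (A i) x"] True by simp
    qed auto
  qed
  also have "\<dots> = (\<integral>\<^sup>+i. \<integral>\<^sup>+x. indicator (A i) x \<partial>M \<partial>count_space D)"
    using assms by (intro nn_integral_count_space_nn_integral) auto
  also have "\<dots> = (\<integral>\<^sup>+i. emeasure M (A i) \<partial>count_space D)"
    using A by (intro nn_integral_cong) auto
  finally show ?thesis .
qed

text \<open>By the Vitali covering theorem almost all of \<open>E\<close> is covered by disjoint intervals of slope less than
  \<open>p\<close> inside an open set barely larger than \<open>E\<close>; their images have total length at most \<open>p\<close> times
  their own, and the uncovered null set has a null image because \<open>F\<close> is Lipschitz.\<close>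

lemma emeasure_image_le_slope:
  fixes F :: "real \<Rightarrow> real"
  assumes lip: "C-lipschitz_on UNIV F" and "mono F" and "0 \<le> p"
    and E: "E \<in> sets borel" and FE: "F ` E \<in> sets borel"
    and slope: "\<And>t. t \<in> E \<Longrightarrow> slopes_below F p t"
  shows "emeasure lborel (F ` E) \<le> ennreal p * emeasure lborel E"
proof (rule ennreal_le_epsilon)
  fix e :: real
  assume "0 < e"
  define e' where "e' = e / (p + 1)"
  have "e' > 0" "p * e' \<le> e"
    using \<open>0 < e\<close> \<open>0 \<le> p\<close> by (auto simp: e'_def field_simps)
  obtain U where U: "open U" "E \<subseteq> U" "emeasure lborel (U - E) < e'"
    using outer_regular_lborel[OF E \<open>e' > 0\<close>] by blast
  \<comment> \<open>Vitali's theorem speaks of closed balls, so intervals are indexed by midpoint and radius.\<close>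
  define K where "K = {(m, r). 0 < r \<and> cball m r \<subseteq> U \<and> F (m + r) - F (m - r) < p * (2 * r)}"
  have pos: "0 < snd i" if "i \<in> K" for i
    using that by (auto simp: K_def)
  have fine: "\<exists>i. i \<in> K \<and> t \<in> cball (fst i) (snd i) \<and> snd i < d" if "t \<in> E" "0 < d" for t d
  proof -
    obtain \<rho> where \<rho>: "\<rho> > 0" "ball t \<rho> \<subseteq> U"
      using U \<open>t \<in> E\<close> openE by blast
    obtain a b where ab: "a < 0" "b > 0" "b - a < min d \<rho>" "F (t + b) - F (t + a) < p * (b - a)"
      using slope[OF \<open>t \<in> E\<close>] \<open>0 < d\<close> \<rho>(1) unfolding slopes_below_def
      by (metis min_less_iff_conj)
    define m r where "m = t + (a + b) / 2" and "r = (b - a) / 2"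
    have mr: "m + r = t + b" "m - r = t + a" "2 * r = b - a"
      by (auto simp: m_def r_def field_simps)
    have "cball m r = {t + a..t + b}"
      using mr by (simp add: cball_eq_atLeastAtMost)
    moreover have "{t + a..t + b} \<subseteq> ball t \<rho>"
      using ab by (auto simp: dist_real_def)
    moreover have "F (m + r) - F (m - r) < p * (2 * r)"
      using ab by (simp only: mr)
    moreover have "0 < r" "r < d"
      using ab by (auto simp: r_def)
    ultimately have "(m, r) \<in> K" "t \<in> cball m r" "r < d"
      using ab \<rho> by (auto simp: K_def)
    then show ?thesis by force
  qed
  obtain D where D: "countable D" "D \<subseteq> K"
     "pairwise (\<lambda>i j. disjnt (cball (fst i) (snd i)) (cball (fst j) (snd j))) D"
     "negligible (E - (\<Union>i \<in> D. cball (fst i) (snd i)))"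
    by (rule Vitali_covering_theorem_cballs[of K snd E fst, OF pos fine])
  define I where "I i = cball (fst i) (snd i)" for i :: "real \<times> real"
  have I_eq: "I i = {fst i - snd i..fst i + snd i}" for i
    by (simp add: I_def cball_eq_atLeastAtMost)
  define N where "N = E - (\<Union>i\<in>D. I i)"
  have I_borel: "(\<Union>i\<in>D. I i) \<in> sets lborel"
    using D(1) by (auto simp: I_def)
  have I_sub: "(\<Union>i\<in>D. I i) \<subseteq> U"
  proof (intro UN_least)
    fix i assume "i \<in> D"
    then have "(fst i, snd i) \<in> K" using D(2) by auto
    then show "I i \<subseteq> U" unfolding K_def I_def by blast
  qed
  have I_meas: "I i \<in> sets borel" for i
    by (simp add: I_eq)
  have negFN: "negligible (F ` N)"
  proof (rule negligible_locally_Lipschitz_image)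
    show "negligible N" using D(4) by (simp add: N_def I_def)
    show "\<exists>T B. open T \<and> x \<in> T \<and> (\<forall>y\<in>N \<inter> T. norm (F y - F x) \<le> B * norm (y - x))" for x
      using lipschitz_on_normD[OF lip] by (intro exI[of _ UNIV] exI[of _ C]) auto
  qed auto
  have "F ` E \<subseteq> F ` N \<union> (\<Union>i\<in>D. {F (fst i - snd i)..F (fst i + snd i)})"
    using mono_image_Icc_subset[OF \<open>mono F\<close>] unfolding N_def I_eq by blast
  then have "emeasure lebesgue (F ` E) \<le>
      emeasure lebesgue (F ` N \<union> (\<Union>i\<in>D. {F (fst i - snd i)..F (fst i + snd i)}))"
    using negFN D(1) by (intro emeasure_mono sets.Un negligible_imp_sets sets.countable_UN') auto
  also have "\<dots> = emeasure lebesgue (\<Union>i\<in>D. {F (fst i - snd i)..F (fst i + snd i)})"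
    using negFN D(1) by (subst Un_commute) (intro emeasure_Un_null_set sets.countable_UN',
        auto simp: negligible_iff_null_sets)
  also have "\<dots> \<le> (\<integral>\<^sup>+i. emeasure lebesgue {F (fst i - snd i)..F (fst i + snd i)} \<partial>count_space D)"
    using D(1) by (intro emeasure_UN_le_nn_integral) auto
  also have "\<dots> \<le> (\<integral>\<^sup>+i. ennreal p * emeasure lborel (I i) \<partial>count_space D)"
  proof (intro nn_integral_mono)
    fix i assume "i \<in> space (count_space D)"
    then have "i \<in> K" using D by auto
    then have i: "0 < snd i" "F (fst i + snd i) - F (fst i - snd i) \<le> p * (2 * snd i)"
      by (auto simp: K_def)
    have "F (fst i - snd i) \<le> F (fst i + snd i)"
      using \<open>mono F\<close> i(1) by (auto simp: mono_def)
    then show "emeasure lebesgue {F (fst i - snd i)..F (fst i + snd i)} \<le> ennreal p * emeasure lborel (I i)"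
      using i \<open>0 \<le> p\<close> by (simp add: I_eq ennreal_mult[symmetric] ennreal_leI)
  qed
  also have "\<dots> = ennreal p * emeasure lborel (\<Union>i\<in>D. I i)"
  proof -
    have "disjoint_family_on I D"
      using D(3) by (auto simp: disjoint_family_on_def pairwise_def disjnt_def I_def)
    then have "emeasure lborel (\<Union>i\<in>D. I i) = (\<integral>\<^sup>+i. emeasure lborel (I i) \<partial>count_space D)"
      using D(1) I_meas by (intro emeasure_UN_countable) auto
    then show ?thesis by (simp add: nn_integral_cmult)
  qed
  also have "\<dots> \<le> ennreal p * emeasure lborel U"
    using I_sub U(1) by (intro mult_left_mono emeasure_mono) auto
  also have "emeasure lborel U = emeasure lborel E + emeasure lborel (U - E)"
    using U E by (subst plus_emeasure) (auto simp: Un_absorb1)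
  also have "ennreal p * (emeasure lborel E + emeasure lborel (U - E)) \<le>
      ennreal p * (emeasure lborel E + ennreal e')"
    using U by (intro mult_left_mono add_left_mono) auto
  also have "\<dots> = ennreal p * emeasure lborel E + ennreal (p * e')"
    using \<open>0 \<le> p\<close> \<open>e' > 0\<close> by (simp add: distrib_left ennreal_mult)
  also have "\<dots> \<le> ennreal p * emeasure lborel E + ennreal e"
    using \<open>p * e' \<le> e\<close> by (intro add_left_mono ennreal_leI) auto
  finally show "emeasure lborel (F ` E) \<le> ennreal p * emeasure lborel E + ennreal e"
    using FE by simp
qed

text \<open>Formulated for a function on any vector space restricted to lines in direction \<open>e\<close>, so that it serves
  both the real line and the slicing argument in higher dimension.\<close>

lemma slopes_below_Gdelta:
  "{x. slopes_below (\<lambda>s. u (x + s *\<^sub>R e)) p 0} =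
     (\<Inter>n::nat. \<Union>(a, b)\<in>{(a, b). a < 0 \<and> 0 < b \<and> b - a < 1 / Suc n}.
        {x. u (x + b *\<^sub>R e) - u (x + a *\<^sub>R e) < p * (b - a)})"
  (is "?L = ?R")
proof
  show "?L \<subseteq> ?R" 
  proof (intro subsetI INT_I)
    fix x and n :: nat
    assume "x \<in> ?L"
    then have *: "\<forall>d>0. \<exists>a<0. \<exists>b>0. b - a < d \<and> u (x + b *\<^sub>R e) - u (x + a *\<^sub>R e) < p * (b - a)"
      by (simp add: slopes_below_def)
    have "0 < 1 / real (Suc n)" by simp
    from *[rule_format, OF this]
    show "x \<in> (\<Union>(a, b)\<in>{(a, b). a < 0 \<and> 0 < b \<and> b - a < 1 / Suc n}.
        {x. u (x + b *\<^sub>R e) - u (x + a *\<^sub>R e) < p * (b - a)})" by blast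
  qed
next
  show "?R \<subseteq> ?L"
  proof
    fix x assume x: "x \<in> ?R"
    show "x \<in> ?L" unfolding slopes_below_def mem_Collect_eq
    proof (intro allI impI)
      fix d :: real assume "d > 0"
      then obtain n where n: "1 / real (Suc n) < d" using nat_approx_posE by blast
      from x obtain a b where "a < 0" "0 < b" "b - a < 1 / Suc n" "u (x + b *\<^sub>R e) - u (x + a *\<^sub>R e) < p * (b - a)"
        by fastforce
      with n show "\<exists>a<0. \<exists>b>0. b - a < d \<and> u (x + (0 + b) *\<^sub>R e) - u (x + (0 + a) *\<^sub>R e) < p * (b - a)"
        by (intro exI[of _ a] exI[of _ b] conjI) auto
    qed
  qed
qed

lemma slopes_below_borel:
  fixes u :: "'a::euclidean_space \<Rightarrow> real"
  assumes "continuous_on UNIV u"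
  shows "{x. slopes_below (\<lambda>s. u (x + s *\<^sub>R e)) p 0} \<in> sets borel"
  unfolding slopes_below_Gdelta
proof (intro sets.countable_INT'')
  fix n :: nat
  have "open (\<Union>(a, b)\<in>{(a, b). a < 0 \<and> 0 < b \<and> b - a < 1 / Suc n}.
        {x. u (x + b *\<^sub>R e) - u (x + a *\<^sub>R e) < p * (b - a)})"
    by (intro open_UN ballI)
       (auto intro!: open_Collect_less continuous_intros continuous_on_compose2[OF assms])
  then show "(\<Union>(a, b)\<in>{(a, b). a < 0 \<and> 0 < b \<and> b - a < 1 / Suc n}.
        {x. u (x + b *\<^sub>R e) - u (x + a *\<^sub>R e) < p * (b - a)}) \<in> sets borel"
    by simp
qed auto

lemma slopes_above_iff: "slopes_above g q t \<longleftrightarrow> slopes_below (\<lambda>s. - g s) (- q) t"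
  unfolding slopes_above_def slopes_below_def by (simp add: algebra_simps)

lemma slopes_above_borel:
  fixes u :: "'a::euclidean_space \<Rightarrow> real"
  assumes "continuous_on UNIV u"
  shows "{x. slopes_above (\<lambda>s. u (x + s *\<^sub>R e)) q 0} \<in> sets borel"
  unfolding slopes_above_iff
  by (rule slopes_below_borel[of "\<lambda>x. - u x"]) (intro continuous_intros assms)

text \<open>Moving the base point, and adding a linear function to reduce to slopes bounded below by \<open>1\<close>.\<close>

lemma slopes_shift:
  "slopes_below (\<lambda>s. g (t + s)) p 0 \<longleftrightarrow> slopes_below g p t"
  "slopes_above (\<lambda>s. g (t + s)) p 0 \<longleftrightarrow> slopes_above g p t"
  by (simp_all add: slopes_below_def slopes_above_def)

lemma slopes_tilt:
  "slopes_below (\<lambda>s. g s + c * s) (p + c) t \<longleftrightarrow> slopes_below g p t"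
  "slopes_above (\<lambda>s. g s + c * s) (p + c) t \<longleftrightarrow> slopes_above g p t"
  by (simp_all add: slopes_below_def slopes_above_def algebra_simps)

text \<open>After adding \<open>(L + 1) t\<close> the function becomes a bi-Lipschitz homeomorphism \<open>F\<close> of the line and \<open>p\<close>,
  \<open>q\<close> become levels \<open>P < Q\<close>, with \<open>1 < P\<close> unless the exceptional set is empty.  On a bounded piece \<open>E\<close> of that set, small slopes of \<open>F\<close>
  give \<open>|F(E)| \<le> P |E|\<close>.  Large slopes of \<open>F\<close> are small slopes of its inverse, so the same lemma gives
  \<open>|E| \<le> |F(E)| / Q\<close>.  Together \<open>|E| \<le> (P / Q) |E|\<close>, which forces \<open>|E| = 0\<close>.\<close>

lemma null_oscillating_slopes:
  fixes g :: "real \<Rightarrow> real"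
  assumes lip: "L-lipschitz_on UNIV g" and "p < q"
  shows "emeasure lborel {t. slopes_below g p t \<and> slopes_above g q t} = 0"
proof -
  define F where "F t = g t + (L + 1) * t" for t
  have "L \<ge> 0" using lip by (rule lipschitz_on_nonneg)
  have glip: "\<bar>g s - g t\<bar> \<le> L * \<bar>s - t\<bar>" for s t
    using lipschitz_on_normD[OF lip] by auto
  have expand: "t - s \<le> F t - F s" if "s \<le> t" for s t
    using glip[of t s] that by (simp add: F_def algebra_simps abs_le_iff)
  have Flip: "(2 * L + 1)-lipschitz_on UNIV F"
  proof (rule lipschitz_onI)
    fix s t
    have "\<bar>F s - F t\<bar> = \<bar>(g s - g t) + (L + 1) * (s - t)\<bar>" by (simp add: F_def algebra_simps)
    also have "\<dots> \<le> L * \<bar>s - t\<bar> + (L + 1) * \<bar>s - t\<bar>"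
      using glip[of s t] \<open>L \<ge> 0\<close> by (intro order_trans[OF abs_triangle_ineq]) (auto simp: abs_mult)
    finally show "dist (F s) (F t) \<le> (2 * L + 1) * dist s t"
      by (simp add: dist_real_def algebra_simps)
  qed (use \<open>L \<ge> 0\<close> in auto)
  have Flip': "F t - F s \<le> (2 * L + 1) * (t - s)" if "s \<le> t" for s t
    using lipschitz_on_normD[OF Flip, of t s] that by (auto simp: abs_le_iff)
  have contF: "continuous_on UNIV F"
    using Flip by (rule lipschitz_on_continuous_on)
  have strict: "strict_mono F"
    using expand by (intro strict_monoI) (metis diff_gt_0_iff_gt less_le_not_le linorder_not_le order_less_le_trans)
  have "bij F"
  proof (rule bijI)
    show "inj F" using strict by (rule strict_mono_imp_inj_on)
    have "\<exists>t. F t = y" for y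
    proof -
      have "\<exists>t. min 0 (y - F 0) \<le> t \<and> t \<le> max 0 (y - F 0) \<and> F t = y"
        using expand[of 0 "max 0 (y - F 0)"] expand[of "min 0 (y - F 0)" 0]
        by (intro IVT' continuous_on_subset[OF contF]) auto
      then show ?thesis by blast
    qed
    then show "surj F" by (metis surjI)
  qed
  define G where "G = inv F"
  have GF [simp]: "G (F t) = t" and FG [simp]: "F (G t) = t" for t
    using \<open>bij F\<close> by (simp_all add: G_def bij_is_inj bij_is_surj surj_f_inv_f)
  have monoG: "mono G"
    by (rule monoI) (metis FG strict strict_mono_less_eq)
  have Glip: "1-lipschitz_on UNIV G"
  proof (rule lipschitz_onI)
    fix x y
    show "dist (G x) (G y) \<le> 1 * dist x y"
      using expand[of "G x" "G y"] expand[of "G y" "G x"] by (auto simp: dist_real_def abs_real_def)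
  qed auto
  have contG: "continuous_on UNIV G"
    using Glip by (rule lipschitz_on_continuous_on)
  define P Q where "P = p + (L + 1)" and "Q = q + (L + 1)"
  have null: "emeasure lborel E = 0" 
    if E_def: "E = {t. slopes_below F P t \<and> slopes_above F Q t} \<inter> {-real n..real n}" for n E
  proof (cases "E = {}")
    case False
    then obtain t where t: "slopes_below F P t" by (auto simp: E_def)
    have "P > 1"
    proof -
      obtain a b where ab: "a < 0" "b > 0" "F (t + b) - F (t + a) < P * (b - a)"
        using t zero_less_one unfolding slopes_below_def by blast
      have "1 * (b - a) = (t + b) - (t + a)" by simp
      also have "\<dots> \<le> F (t + b) - F (t + a)"
        using ab by (intro expand) auto
      also note ab(3)
      finally show ?thesis
        using ab by (simp only: mult_less_cancel_right)
    qed
    have "Q > P" using \<open>p < q\<close> by (simp add: P_def Q_def)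
    have E: "E \<in> sets borel"
      using slopes_below_borel[OF contF, where e=1 and p=P] slopes_above_borel[OF contF, where e=1 and q=Q]
      by (simp add: E_def slopes_shift Collect_conj_eq)
    have "F ` E = G -` E" by (auto simp: image_iff) (metis FG)
    then have FE: "F ` E \<in> sets borel"
      using measurable_sets[OF borel_measurable_continuous_onI[OF contG] E] by simp
    have GFE: "G ` (F ` E) = E" by (auto simp: image_image)
    have le1: "emeasure lborel (F ` E) \<le> ennreal P * emeasure lborel E"
      using \<open>P > 1\<close> strict by (intro emeasure_image_le_slope[OF Flip _ _ E FE])
        (auto simp: E_def strict_mono_mono)
    \<comment> \<open>An interval around \<open>t\<close> of slope above \<open>Q\<close> is mapped to an interval around \<open>F t\<close> over which the
      inverse has slope below \<open>1 / Q\<close>; it is short because \<open>F\<close> is Lipschitz.\<close>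
    have "slopes_below G (1 / Q) y" if "y \<in> F ` E" for y
      unfolding slopes_below_def
    proof (intro allI impI)
      fix d :: real assume "d > 0"
      from that obtain t where t: "y = F t" "slopes_above F Q t" by (auto simp: E_def)
      have "d / (2 * L + 1) > 0" using \<open>d > 0\<close> \<open>L \<ge> 0\<close> by simp
      then obtain a b where ab: "a < 0" "b > 0" "b - a < d / (2 * L + 1)"
          "Q * (b - a) < F (t + b) - F (t + a)"
        using t(2) unfolding slopes_above_def by blast
      define a' b' where "a' = F (t + a) - F t" and "b' = F (t + b) - F t"
      have "a' < 0" "b' > 0" using strict ab by (auto simp: a'_def b'_def strict_mono_less)
      have "b' - a' \<le> (2 * L + 1) * (b - a)"
        using Flip'[of "t + a" "t + b"] ab by (simp add: a'_def b'_def)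
      also have "\<dots> < d" using ab(3) \<open>L \<ge> 0\<close> by (simp add: field_simps)
      finally have "b' - a' < d" .
      have "G (y + b') - G (y + a') = b - a" by (simp add: a'_def b'_def t(1))
      also have "\<dots> < 1 / Q * (b' - a')"
        using ab(4) \<open>Q > P\<close> \<open>P > 1\<close> by (simp add: a'_def b'_def field_simps)
      finally show "\<exists>a<0. \<exists>b>0. b - a < d \<and> G (y + b) - G (y + a) < 1 / Q * (b - a)"
        using \<open>a' < 0\<close> \<open>b' > 0\<close> \<open>b' - a' < d\<close> by blast
    qed
    then have le2: "emeasure lborel E \<le> ennreal (1 / Q) * emeasure lborel (F ` E)"
      using emeasure_image_le_slope[OF Glip monoG, of "1 / Q" "F ` E"] FE E \<open>Q > P\<close> \<open>P > 1\<close>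
      by (simp add: GFE)
    have fin: "emeasure lborel E < \<infinity>"
    proof -
      have "emeasure lborel E \<le> emeasure lborel {-real n..real n}"
        by (intro emeasure_mono) (auto simp: E_def)
      then show ?thesis by (simp add: le_less_trans)
    qed
    then obtain m where m: "m \<ge> 0" "emeasure lborel E = ennreal m"
      by (metis ennreal_cases infinity_ennreal_def less_irrefl)
    have "ennreal m \<le> ennreal (1 / Q) * (ennreal P * ennreal m)"
      using order_trans[OF le2 mult_left_mono[OF le1]] by (simp add: m)
    then have "m \<le> 1 / Q * (P * m)"
      using m(1) \<open>Q > P\<close> \<open>P > 1\<close> by (simp add: ennreal_mult[symmetric])
    then have "m * (Q - P) \<le> 0" using \<open>Q > P\<close> \<open>P > 1\<close> by (simp add: field_simps)
    then have "m = 0" using m(1) \<open>Q > P\<close> by (simp add: mult_le_0_iff)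
    then show ?thesis using m by simp
  qed auto
  have "{t. slopes_below g p t \<and> slopes_above g q t} =
     (\<Union>n::nat. {t. slopes_below F P t \<and> slopes_above F Q t} \<inter> {-real n..real n})"
  proof -
    have "\<exists>n::nat. - real n \<le> t \<and> t \<le> real n" for t
      using real_arch_simple[of "\<bar>t\<bar>"] by (metis abs_le_iff minus_le_iff)
    then show ?thesis
      unfolding F_def P_def Q_def slopes_tilt by auto
  qed
  moreover have "{t. slopes_below F P t \<and> slopes_above F Q t} \<inter> {-real n..real n} \<in> null_sets lborel" for n
  proof -
    have "{t. slopes_below F P t \<and> slopes_above F Q t} \<inter> {-real n..real n} \<in> sets borel"
      using slopes_below_borel[OF contF, where e=1 and p=P] slopes_above_borel[OF contF, where e=1 and q=Q]
      by (simp add: slopes_shift Collect_conj_eq)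
    then show ?thesis using null[OF refl] by (auto simp: null_sets_def)
  qed
  ultimately have "{t. slopes_below g p t \<and> slopes_above g q t} \<in> null_sets lborel"
    by (simp only:) (rule null_sets_UN)
  then show ?thesis by (rule null_setsD1)
qed

section \<open>Partial derivatives of Lipschitz functions\<close>

lemma slopes_below_mono: "slopes_below g p t \<Longrightarrow> p \<le> p' \<Longrightarrow> slopes_below g p' t"
proof -
  assume *: "slopes_below g p t" "p \<le> p'"
  have "p * (b - a) \<le> p' * (b - a)" if "a < 0" "0 < b" for a b :: real
    using that *(2) by (intro mult_right_mono) auto
  then show ?thesis using *(1) unfolding slopes_below_def by (meson order_less_le_trans)
qed

lemma slopes_above_antimono: "slopes_above g q t \<Longrightarrow> q' \<le> q \<Longrightarrow> slopes_above g q' t"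
  by (simp add: slopes_above_iff slopes_below_mono)

text \<open>The derivative is the infimum \<open>D\<close> of all levels \<open>p\<close> with arbitrarily short intervals of slope below \<open>p\<close>.
  Slopes over short intervals exceed any level under \<open>D\<close>, by definition of the infimum; slopes that keep exceeding some
  level over \<open>D\<close> would oscillate across two rational levels.\<close>

lemma differentiable_if_slopes_do_not_oscillate:
  fixes g :: "real \<Rightarrow> real"
  assumes lip: "L-lipschitz_on UNIV g"
    and no: "\<And>p q. p \<in> \<rat> \<Longrightarrow> q \<in> \<rat> \<Longrightarrow> p < q \<Longrightarrow> \<not> (slopes_below g p 0 \<and> slopes_above g q 0)"
  shows "\<exists>D. (g has_field_derivative D) (at 0)"
proof -
  define S where "S = {p. slopes_below g p 0}"
  define D where "D = Inf S"
  have glip: "\<bar>g s - g t\<bar> \<le> L * \<bar>s - t\<bar>" for s t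
    using lipschitz_on_normD[OF lip] by auto
  have cont: "isCont g t" for t
    using lipschitz_on_continuous_on[OF lip] by (simp add: continuous_on_eq_continuous_at)
  have "L + 1 \<in> S"
    unfolding S_def mem_Collect_eq slopes_below_def
  proof (intro allI impI)
    fix d :: real assume "d > 0"
    have "\<bar>d / 3 - - d / 3\<bar> = d / 3 - - d / 3" using \<open>d > 0\<close> by simp
    then have "g (0 + d / 3) - g (0 + - d / 3) \<le> L * (d / 3 - - d / 3)"
      using glip[of "d/3" "-d/3"] by (metis abs_le_D1 add_0)
    also have "\<dots> < (L + 1) * (d / 3 - - d / 3)"
      using \<open>d > 0\<close> by (intro mult_strict_right_mono) auto
    finally show "\<exists>a<0. \<exists>b>0. b - a < d \<and> g (0 + b) - g (0 + a) < (L + 1) * (b - a)"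
      using \<open>d > 0\<close> by (intro exI[of _ "-d/3"] conjI exI[of _ "d/3"]) auto
  qed
  have lower: "- L \<le> p" if pS: "p \<in> S" for p
  proof -
    have "slopes_below g p 0" using pS by (simp add: S_def)
    then obtain a b where ab: "a < 0" "b > 0" "g b - g a < p * (b - a)"
      using zero_less_one unfolding slopes_below_def by (metis add_0)
    have "- L * (b - a) \<le> g b - g a" using glip[of b a] ab by (auto simp: abs_le_iff)
    also note ab(3)
    finally show ?thesis using ab by (simp only: mult_less_cancel_right) auto
  qed
  have bdd: "bdd_below S" using lower by (auto simp: bdd_below_def)
  have close: "\<exists>d>0. \<forall>a<0. \<forall>b>0. b - a < d \<longrightarrow> \<bar>g b - g a - D * (b - a)\<bar> \<le> e * (b - a)"
    if "e > 0" for e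
  proof -
    have "D - e \<notin> S"
      using cInf_lower[OF _ bdd, of "D - e"] \<open>e > 0\<close> by (auto simp: D_def)
    then have "\<not> slopes_below g (D - e) 0" by (simp add: S_def)
    then obtain d1 where d1: "d1 > 0"
        "\<And>a b. a < 0 \<Longrightarrow> b > 0 \<Longrightarrow> b - a < d1 \<Longrightarrow> (D - e) * (b - a) \<le> g b - g a"
      unfolding slopes_below_def by (metis add_0 not_less)
    have "\<not> slopes_above g (D + e) 0"
    proof
      assume above: "slopes_above g (D + e) 0"
      obtain s where s: "s \<in> S" "s < D + e"
        using \<open>e > 0\<close> \<open>L + 1 \<in> S\<close> cInf_lessD[of S "D + e"] unfolding D_def by auto
      obtain p where p: "p \<in> \<rat>" "s < p" "p < D + e" using Rats_dense_in_real[OF s(2)] by blast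
      obtain q where q: "q \<in> \<rat>" "p < q" "q < D + e" using Rats_dense_in_real[OF p(3)] by blast
      have "slopes_below g p 0" using s p slopes_below_mono[of g s 0 p] by (auto simp: S_def)
      moreover have "slopes_above g q 0" using above q slopes_above_antimono by fastforce
      ultimately show False using no[OF p(1) q(1,2)] by blast
    qed
    then obtain d2 where d2: "d2 > 0"
        "\<And>a b. a < 0 \<Longrightarrow> b > 0 \<Longrightarrow> b - a < d2 \<Longrightarrow> g b - g a \<le> (D + e) * (b - a)"
      unfolding slopes_above_def by (metis add_0 not_less)
    show ?thesis
    proof (intro exI[of _ "min d1 d2"] conjI allI impI)
      fix a b :: real assume "a < 0" "0 < b" "b - a < min d1 d2"
      then have "(D - e) * (b - a) \<le> g b - g a" "g b - g a \<le> (D + e) * (b - a)"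
        using d1(2)[of a b] d2(2)[of a b] by auto
      then show "\<bar>g b - g a - D * (b - a)\<bar> \<le> e * (b - a)"
        unfolding abs_le_iff by (simp add: algebra_simps)
    qed (use d1 d2 in auto)
  qed
  have "((\<lambda>h. (g (0 + h) - g 0) / h) \<longlongrightarrow> D) (at 0)"
  proof (rule LIM_I)
    fix r :: real assume "r > 0"
    then obtain d where d: "d > 0"
        "\<And>a b. a < 0 \<Longrightarrow> b > 0 \<Longrightarrow> b - a < d \<Longrightarrow> \<bar>g b - g a - D * (b - a)\<bar> \<le> r / 2 * (b - a)"
      using close[of "r / 2"] by auto
    have pos: "\<bar>g b - g 0 - D * b\<bar> \<le> r / 2 * b" if "0 < b" "b < d" for b
    proof -
      \<comment> \<open>The straddling estimate becomes a one-sided difference quotient when the other endpoint tends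
        to \<open>0\<close>.\<close>
      have lim: "((\<lambda>a. \<bar>g b - g a - D * (b - a)\<bar> - r / 2 * (b - a)) \<longlongrightarrow>
             \<bar>g b - g 0 - D * (b - 0)\<bar> - r / 2 * (b - 0)) (at_left 0)"
        using cont[of 0] unfolding isCont_def by (intro tendsto_intros) (auto simp: filterlim_at_split)
      have "\<forall>\<^sub>F a in at_left 0. \<bar>g b - g a - D * (b - a)\<bar> - r / 2 * (b - a) \<le> 0"
        unfolding eventually_at_left_field
        using d(2)[of _ b] that by (intro exI[of _ "b - d"]) (auto simp: le_diff_eq)
      from tendsto_upperbound[OF lim this] show ?thesis by simp
    qed
    have neg: "\<bar>g 0 - g a + D * a\<bar> \<le> r / 2 * (- a)" if "a < 0" "- a < d" for a
    proof -
      have lim: "((\<lambda>b. \<bar>g b - g a - D * (b - a)\<bar> - r / 2 * (b - a)) \<longlongrightarrow>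
             \<bar>g 0 - g a - D * (0 - a)\<bar> - r / 2 * (0 - a)) (at_right 0)"
        using cont[of 0] unfolding isCont_def by (intro tendsto_intros) (auto simp: filterlim_at_split)
      have "\<forall>\<^sub>F b in at_right 0. \<bar>g b - g a - D * (b - a)\<bar> - r / 2 * (b - a) \<le> 0"
        unfolding eventually_at_right_field
        using d(2)[of a] that by (intro exI[of _ "a + d"]) (auto simp: le_diff_eq)
      from tendsto_upperbound[OF lim this] show ?thesis by simp
    qed
    have "norm ((g (0 + h) - g 0) / h - D) < r" if "h \<noteq> 0" "norm (h - 0) < d" for h
    proof -
      have "\<bar>g h - g 0 - D * h\<bar> \<le> r / 2 * \<bar>h\<bar>"
        using pos[of h] neg[of h] that by (cases "h > 0") (auto simp: abs_minus_commute abs_le_iff)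
      moreover have "(g (0 + h) - g 0) / h - D = (g h - g 0 - D * h) / h"
        using that by (simp add: field_simps)
      ultimately have "norm ((g (0 + h) - g 0) / h - D) \<le> r / 2"
        using that by (simp add: divide_le_eq)
      then show ?thesis using \<open>r > 0\<close> by simp
    qed
    then show "\<exists>s>0. \<forall>x. x \<noteq> 0 \<and> norm (x - 0) < s \<longrightarrow> norm ((g (0 + x) - g 0) / x - D) < r"
      using d(1) by blast
  qed
  then show ?thesis by (auto simp: DERIV_def)
qed

text \<open>Tonelli's theorem for \<open>1\<^sub>N (x + t e)\<close> on the product of the space with the real line: integrating in \<open>t\<close>
  first gives \<open>0\<close>, integrating in \<open>x\<close> first gives \<open>|N|\<close> for every \<open>t\<close> by translation invariance, so
  \<open>|N|\<close> times the infinite length of the line vanishes.\<close>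

lemma null_if_line_sections_null:
  fixes N :: "'a::euclidean_space set"
  assumes N [measurable]: "N \<in> sets borel"
    and sec: "\<And>x. emeasure lborel {t::real. x + t *\<^sub>R e \<in> N} = 0"
  shows "N \<in> null_sets lborel"
proof -
  have "(\<integral>\<^sup>+x. \<integral>\<^sup>+t. indicator N (x + t *\<^sub>R e) \<partial>(lborel::real measure) \<partial>lborel) = 0"
  proof -
    have "(\<integral>\<^sup>+t. indicator N (x + t *\<^sub>R e) \<partial>(lborel::real measure)) = 0" for x
    proof -
      have "(\<integral>\<^sup>+t. indicator N (x + t *\<^sub>R e) \<partial>(lborel::real measure)) =
          (\<integral>\<^sup>+t. indicator {t. x + t *\<^sub>R e \<in> N} t \<partial>lborel)"
        by (intro nn_integral_cong) (auto simp: indicator_def)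
      then show ?thesis using sec[of x] by simp
    qed
    then show ?thesis by simp
  qed
  moreover have "(\<integral>\<^sup>+x. \<integral>\<^sup>+t. indicator N (x + t *\<^sub>R e) \<partial>(lborel::real measure) \<partial>lborel) =
      (\<integral>\<^sup>+t. \<integral>\<^sup>+x. indicator N (x + t *\<^sub>R e) \<partial>lborel \<partial>(lborel::real measure))"
    by (rule lborel_pair.Fubini'[symmetric]) measurable
  moreover have "(\<integral>\<^sup>+x. indicator N (x + t *\<^sub>R e) \<partial>lborel) = emeasure lborel N" for t
  proof -
    have "emeasure lborel N = (\<integral>\<^sup>+x. indicator N x \<partial>distr lborel borel ((+) (t *\<^sub>R e)))"
      by (subst lborel_distr_plus) simp
    also have "\<dots> = (\<integral>\<^sup>+x. indicator N (t *\<^sub>R e + x) \<partial>lborel)"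
      by (rule nn_integral_distr) measurable
    finally show ?thesis by (simp add: add.commute)
  qed
  ultimately have "emeasure lborel N * \<infinity> = 0" by simp
  then show ?thesis using N by (auto simp: null_sets_def)
qed

text \<open>Every line section of an oscillation set is null by the one-dimensional result, and countably many
  oscillation sets, for rational \<open>p < q\<close>, exhaust the points without a partial derivative.\<close>

lemma AE_partial_derivative_exists:
  fixes u :: "'a::euclidean_space \<Rightarrow> real"
  assumes lip: "L-lipschitz_on UNIV u"
  shows "AE x in lebesgue. \<exists>D. ((\<lambda>t. u (x + t *\<^sub>R e)) has_field_derivative D) (at 0)"
proof -
  define B A where "B p = {x. slopes_below (\<lambda>s. u (x + s *\<^sub>R e)) p 0}"
    and "A q = {x. slopes_above (\<lambda>s. u (x + s *\<^sub>R e)) q 0}" for p q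
  have cont: "continuous_on UNIV u" using lip by (rule lipschitz_on_continuous_on)
  have line: "(L * norm e)-lipschitz_on UNIV (\<lambda>s. u (x + s *\<^sub>R e))" for x
  proof (rule lipschitz_onI)
    fix s t :: real
    have "dist (u (x + s *\<^sub>R e)) (u (x + t *\<^sub>R e)) \<le> L * dist (x + s *\<^sub>R e) (x + t *\<^sub>R e)"
      using lip by (rule lipschitz_onD) auto
    also have "dist (x + s *\<^sub>R e) (x + t *\<^sub>R e) = dist s t * norm e"
      by (simp add: dist_norm flip: scaleR_left_diff_distrib)
    finally show "dist (u (x + s *\<^sub>R e)) (u (x + t *\<^sub>R e)) \<le> L * norm e * dist s t"
      by (simp add: mult_ac)
  qed (use lipschitz_on_nonneg[OF lip] in auto)
  have null: "B p \<inter> A q \<in> null_sets lborel" if "p < q" for p q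
  proof (rule null_if_line_sections_null[where e=e])
    show "B p \<inter> A q \<in> sets borel"
      using slopes_below_borel[OF cont] slopes_above_borel[OF cont] by (simp add: A_def B_def)
    fix x
    have "{t. x + t *\<^sub>R e \<in> B p \<inter> A q} =
       {t. slopes_below (\<lambda>s. u (x + s *\<^sub>R e)) p t \<and> slopes_above (\<lambda>s. u (x + s *\<^sub>R e)) q t}"
      using slopes_shift[of "\<lambda>s. u (x + s *\<^sub>R e)"] by (simp add: A_def B_def algebra_simps)
    then show "emeasure lborel {t. x + t *\<^sub>R e \<in> B p \<inter> A q} = 0"
      using null_oscillating_slopes[OF line \<open>p < q\<close>] by simp
  qed
  define N where "N = (\<Union>(p, q)\<in>{(p, q). p \<in> \<rat> \<and> q \<in> \<rat> \<and> p < q}. B p \<inter> A q)"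
  have "countable {(p::real, q). p \<in> \<rat> \<and> q \<in> \<rat> \<and> p < q}"
    by (rule countable_subset[of _ "\<rat> \<times> \<rat>"]) (auto simp: countable_rat)
  then have "N \<in> null_sets lborel"
    unfolding N_def using null by (intro null_sets_UN') auto
  moreover have "\<exists>D. ((\<lambda>t. u (x + t *\<^sub>R e)) has_field_derivative D) (at 0)" if "x \<notin> N" for x
    using that by (intro differentiable_if_slopes_do_not_oscillate[OF line]) (auto simp: N_def A_def B_def)
  ultimately have "AE x in lborel. \<exists>D. ((\<lambda>t. u (x + t *\<^sub>R e)) has_field_derivative D) (at 0)"
    by (intro AE_I'[of N]) auto
  then show ?thesis by (rule AE_completion)
qed

section \<open>Test fields and the pairing with the divergence\<close>

text \<open>Fields on the whole space with compact support in \<open>V\<close>.  They carry the same information as \<open>Lip_c V\<close>,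
  whose members are constrained on \<open>V\<close> only, but sums of fields for different \<open>V\<close> make sense.\<close>

definition test_fields :: "'a::euclidean_space set \<Rightarrow> ('a \<Rightarrow> 'a) set" where
  "test_fields V = {\<phi>. (\<exists>C. C-lipschitz_on UNIV \<phi>) \<and>
     (\<exists>S. compact S \<and> S \<subseteq> V \<and> (\<forall>x. x \<notin> S \<longrightarrow> \<phi> x = 0))}"

lemma test_fieldsI:
  "C-lipschitz_on UNIV \<phi> \<Longrightarrow> compact S \<Longrightarrow> S \<subseteq> V \<Longrightarrow> (\<And>x. x \<notin> S \<Longrightarrow> \<phi> x = 0) \<Longrightarrow> \<phi> \<in> test_fields V"
  unfolding test_fields_def by blast

lemma test_fieldsE:
  assumes "\<phi> \<in> test_fields V"
  obtains C S where "C-lipschitz_on UNIV \<phi>" "compact S" "S \<subseteq> V" "\<And>x. x \<notin> S \<Longrightarrow> \<phi> x = 0"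
  using assms unfolding test_fields_def by blast

lemma test_fields_mono: "V \<subseteq> W \<Longrightarrow> test_fields V \<subseteq> test_fields W"
  unfolding test_fields_def by blast

lemma test_fields_zero_outside: "\<phi> \<in> test_fields V \<Longrightarrow> x \<notin> V \<Longrightarrow> \<phi> x = 0"
  unfolding test_fields_def by blast

lemma test_fields_bounded:
  assumes "\<phi> \<in> test_fields V"
  obtains M where "M > 0" "\<And>x. norm (\<phi> x) \<le> M"
proof -
  obtain C S where CS: "C-lipschitz_on UNIV \<phi>" "compact S" "\<And>x. x \<notin> S \<Longrightarrow> \<phi> x = 0"
    using assms by (metis test_fieldsE)
  have "bounded (\<phi> ` S)"
    by (intro compact_imp_bounded compact_continuous_image CS
        continuous_on_subset[OF lipschitz_on_continuous_on[OF CS(1)]]) auto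
  then obtain M where M: "M > 0" "\<And>x. x \<in> S \<Longrightarrow> norm (\<phi> x) \<le> M"
    by (auto simp: bounded_pos)
  then have "norm (\<phi> x) \<le> M" for x
    using CS(3)[of x] by (cases "x \<in> S") auto
  with M that show thesis by blast
qed

lemma test_fields_linear:
  assumes "\<phi> \<in> test_fields V" "\<psi> \<in> test_fields V"
  shows "(\<lambda>x. a *\<^sub>R \<phi> x + b *\<^sub>R \<psi> x) \<in> test_fields V"
proof -
  obtain C S where 1: "C-lipschitz_on UNIV \<phi>" "compact S" "S \<subseteq> V" "\<And>x. x \<notin> S \<Longrightarrow> \<phi> x = 0"
    using assms(1) unfolding test_fields_def by blast
  obtain D T where 2: "D-lipschitz_on UNIV \<psi>" "compact T" "T \<subseteq> V" "\<And>x. x \<notin> T \<Longrightarrow> \<psi> x = 0"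
    using assms(2) unfolding test_fields_def by blast
  show ?thesis
  proof (rule test_fieldsI)
    show "(\<bar>a\<bar> * C + \<bar>b\<bar> * D)-lipschitz_on UNIV (\<lambda>x. a *\<^sub>R \<phi> x + b *\<^sub>R \<psi> x)"
      using 1 2 by (intro lipschitz_intros)
    show "compact (S \<union> T)" using 1 2 by (intro compact_Un)
  qed (use 1 2 in auto)
qed

lemma test_fields_zero: "(\<lambda>x. 0) \<in> test_fields V"
  by (rule test_fieldsI[of 0 _ "{}"]) (auto intro: lipschitz_intros)

text \<open>Products of bounded Lipschitz functions are Lipschitz.  The support \<open>S\<close> is a separate parameter
  because a cutoff is used precisely to move a field into a smaller open set.\<close>

lemma test_fields_mult:
  fixes \<eta> :: "'a::euclidean_space \<Rightarrow> real"
  assumes \<phi>: "\<phi> \<in> test_fields V"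
    and \<eta>: "D-lipschitz_on UNIV \<eta>" "\<And>x. \<bar>\<eta> x\<bar> \<le> 1"
    and S: "compact S" "S \<subseteq> W" "\<And>x. x \<notin> S \<Longrightarrow> \<eta> x *\<^sub>R \<phi> x = 0"
  shows "(\<lambda>x. \<eta> x *\<^sub>R \<phi> x) \<in> test_fields W"
proof -
  obtain C where C: "C-lipschitz_on UNIV \<phi>" using \<phi> by (metis test_fieldsE)
  obtain M where M: "M > 0" "\<And>x. norm (\<phi> x) \<le> M" using \<phi> by (metis test_fields_bounded)
  have "(C + D * M)-lipschitz_on UNIV (\<lambda>x. \<eta> x *\<^sub>R \<phi> x)"
  proof (rule lipschitz_onI)
    fix x y
    have "\<eta> x *\<^sub>R \<phi> x - \<eta> y *\<^sub>R \<phi> y = \<eta> x *\<^sub>R (\<phi> x - \<phi> y) + (\<eta> x - \<eta> y) *\<^sub>R \<phi> y"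
      by (simp add: algebra_simps)
    then have "dist (\<eta> x *\<^sub>R \<phi> x) (\<eta> y *\<^sub>R \<phi> y) \<le>
        \<bar>\<eta> x\<bar> * norm (\<phi> x - \<phi> y) + \<bar>\<eta> x - \<eta> y\<bar> * norm (\<phi> y)"
      unfolding dist_norm by (metis norm_scaleR norm_triangle_ineq)
    also have "\<dots> \<le> 1 * (C * dist x y) + (D * dist x y) * M"
    proof (intro add_mono mult_mono)
      show "norm (\<phi> x - \<phi> y) \<le> C * dist x y"
        using lipschitz_onD[OF C, of x y] by (simp add: dist_norm)
      show "\<bar>\<eta> x - \<eta> y\<bar> \<le> D * dist x y"
        using lipschitz_onD[OF \<eta>(1), of x y] by (simp add: dist_norm)
      show "0 \<le> D * dist x y" using lipschitz_on_nonneg[OF \<eta>(1)] by simp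
    qed (use \<eta>(2) M(2) in auto)
    finally show "dist (\<eta> x *\<^sub>R \<phi> x) (\<eta> y *\<^sub>R \<phi> y) \<le> (C + D * M) * dist x y"
      by (simp add: algebra_simps)
  qed (use M lipschitz_on_nonneg[OF C] lipschitz_on_nonneg[OF \<eta>(1)] in auto)
  then show ?thesis using S by (rule test_fieldsI)
qed

lemma test_fields_subset_Lip_c:
  assumes "\<phi> \<in> test_fields V"
  shows "\<phi> \<in> Lip_c V"
proof -
  obtain C S where S: "C-lipschitz_on UNIV \<phi>" "compact S" "S \<subseteq> V" "\<And>x. x \<notin> S \<Longrightarrow> \<phi> x = 0"
    using assms unfolding test_fields_def by blast
  have sub: "closure {x \<in> V. \<phi> x \<noteq> 0} \<subseteq> S"
    using S by (intro closure_minimal compact_imp_closed) auto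
  have "compact (closure {x \<in> V. \<phi> x \<noteq> 0})"
    using sub compact_Int_closed[OF S(2) closed_closure, of "{x \<in> V. \<phi> x \<noteq> 0}"] by (simp add: Int_absorb1)
  moreover have "C-lipschitz_on V \<phi>" using S(1) by (rule lipschitz_on_subset) auto
  ultimately show ?thesis using sub S(3) unfolding Lip_c_def by blast
qed

text \<open>The support has positive distance \<open>d\<close> from the complement of \<open>V\<close>.  A bounded field may therefore drop to
  \<open>0\<close> outside \<open>V\<close> at the cost of the additional Lipschitz constant \<open>M / d\<close>.\<close>

lemma Lip_c_extend_zero:
  assumes "open V" and "\<phi> \<in> Lip_c V"
  shows "(\<lambda>x. if x \<in> V then \<phi> x else 0) \<in> test_fields V"
proof -
  define K where "K = closure {x \<in> V. \<phi> x \<noteq> 0}"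
  obtain C where C: "C-lipschitz_on V \<phi>" and K: "compact K" "K \<subseteq> V"
    using assms(2) by (auto simp: Lip_c_def K_def)
  have zero: "\<phi> x = 0" if "x \<in> V" "x \<notin> K" for x
    using that closure_subset[of "{x \<in> V. \<phi> x \<noteq> 0}"] unfolding K_def by blast
  have "bounded (\<phi> ` K)"
    by (intro compact_imp_bounded compact_continuous_image K
        continuous_on_subset[OF lipschitz_on_continuous_on[OF C]])
  then obtain M where M: "M > 0" "\<And>x. x \<in> K \<Longrightarrow> norm (\<phi> x) \<le> M"
    by (auto simp: bounded_pos)
  obtain d where d: "d > 0" "\<And>x y. x \<in> K \<Longrightarrow> y \<in> - V \<Longrightarrow> d \<le> dist x y"
    using separate_compact_closed[OF K(1), of "- V"] K(2) closed_Compl[OF \<open>open V\<close>] by blast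
  have C0: "C \<ge> 0" using C by (rule lipschitz_on_nonneg)
  let ?\<psi> = "\<lambda>x. if x \<in> V then \<phi> x else 0"
  have outside: "norm (\<phi> x) \<le> M / d * dist x y" if "x \<in> V" "y \<notin> V" for x y
  proof (cases "x \<in> K")
    case True
    have "norm (\<phi> x) \<le> M / d * d" using M(2)[OF True] d(1) by simp
    also have "\<dots> \<le> M / d * dist x y"
      using d M True that by (intro mult_left_mono) auto
    finally show ?thesis .
  qed (use zero that M d in auto)
  show ?thesis
  proof (rule test_fieldsI[OF _ K])
    show "(C + M / d)-lipschitz_on UNIV ?\<psi>"
    proof (rule lipschitz_onI)
      fix x y :: 'a
      have pos: "0 \<le> C * dist x y" "0 \<le> M / d * dist x y" using C0 M d by auto
      consider "x \<in> V" "y \<in> V" | "x \<in> V" "y \<notin> V" | "x \<notin> V" "y \<in> V" | "x \<notin> V" "y \<notin> V" by blast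
      then show "dist (?\<psi> x) (?\<psi> y) \<le> (C + M / d) * dist x y"
      proof cases
        case 1 then show ?thesis using lipschitz_onD[OF C 1] pos by (simp add: distrib_right)
      next
        case 2 then show ?thesis using outside[OF 2] pos by (simp add: distrib_right)
      next
        case 3 then show ?thesis using outside[OF 3(2,1)] pos by (simp add: distrib_right dist_commute)
      next
        case 4 then show ?thesis using pos by (simp add: distrib_right)
      qed
    qed (use C0 M d in auto)
  qed (use zero in auto)
qed

lemma divergence_cong_open:
  assumes "open V" "x \<in> V" and eq: "\<And>y. y \<in> V \<Longrightarrow> \<phi> y = \<psi> y"
  shows "divergence \<phi> x = divergence \<psi> x"
  unfolding divergence_def
proof (intro sum.cong deriv_cong_ev refl)
  fix b :: 'a
  have "open {t. x + t *\<^sub>R b \<in> V}"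
    using continuous_open_vimage[OF \<open>open V\<close>, of "\<lambda>t. x + t *\<^sub>R b"] by (simp add: vimage_def)
  then have "\<forall>\<^sub>F t in nhds 0. x + t *\<^sub>R b \<in> V"
    using eventually_nhds_in_open[of "{t. x + t *\<^sub>R b \<in> V}" 0] \<open>x \<in> V\<close> by simp
  then show "\<forall>\<^sub>F t in nhds 0. \<phi> (x + t *\<^sub>R b) \<bullet> b = \<psi> (x + t *\<^sub>R b) \<bullet> b"
    by eventually_elim (simp add: eq)
qed

lemma divergence_zero [simp]: "divergence (\<lambda>x. 0) x = 0"
  by (simp add: divergence_def)

lemma divergence_outside_support:
  assumes "compact S" "\<And>x. x \<notin> S \<Longrightarrow> \<phi> x = 0" "x \<notin> S"
  shows "divergence \<phi> x = 0"
  using divergence_cong_open[of "- S" x \<phi> "\<lambda>x. 0"] assms compact_imp_closed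
  by (auto simp: open_Compl)

lemma lipschitz_component:
  fixes \<phi> :: "'a::euclidean_space \<Rightarrow> 'a"
  assumes "C-lipschitz_on UNIV \<phi>" "b \<in> Basis"
  shows "C-lipschitz_on UNIV (\<lambda>x. \<phi> x \<bullet> b)"
proof (rule lipschitz_onI)
  fix x y
  have "dist (\<phi> x \<bullet> b) (\<phi> y \<bullet> b) \<le> dist (\<phi> x) (\<phi> y)"
    using Basis_le_norm[OF assms(2), of "\<phi> x - \<phi> y"] by (simp add: dist_norm inner_diff_left)
  also have "\<dots> \<le> C * dist x y" using assms(1) by (rule lipschitz_onD) auto
  finally show "dist (\<phi> x \<bullet> b) (\<phi> y \<bullet> b) \<le> C * dist x y" .
qed (rule lipschitz_on_nonneg[OF assms(1)])

text \<open>The points at which \<open>divergence\<close> is the genuine sum of partial derivatives and hence linear.\<close>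

definition has_partials :: "('a::euclidean_space \<Rightarrow> 'a) \<Rightarrow> 'a \<Rightarrow> bool" where
  "has_partials \<phi> x \<longleftrightarrow>
     (\<forall>b\<in>Basis. \<exists>D. ((\<lambda>t. \<phi> (x + t *\<^sub>R b) \<bullet> b) has_field_derivative D) (at 0))"

lemma AE_has_partials:
  assumes "C-lipschitz_on UNIV \<phi>"
  shows "AE x in lebesgue. has_partials \<phi> x"
  unfolding has_partials_def
  by (rule AE_finite_allI) (auto intro!: AE_partial_derivative_exists lipschitz_component assms)

lemma divergence_linear:
  assumes "has_partials \<phi> x" "has_partials \<psi> x"
  shows "divergence (\<lambda>x. a *\<^sub>R \<phi> x + b *\<^sub>R \<psi> x) x = a * divergence \<phi> x + b * divergence \<psi> x"
  unfolding divergence_def sum_distrib_left sum.distrib[symmetric]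
proof (rule sum.cong[OF refl])
  fix e :: 'a assume "e \<in> Basis"
  then obtain D E where
    D: "((\<lambda>t. \<phi> (x + t *\<^sub>R e) \<bullet> e) has_field_derivative D) (at 0)" and
    E: "((\<lambda>t. \<psi> (x + t *\<^sub>R e) \<bullet> e) has_field_derivative E) (at 0)"
    using assms unfolding has_partials_def by blast
  have "((\<lambda>t. (a *\<^sub>R \<phi> (x + t *\<^sub>R e) + b *\<^sub>R \<psi> (x + t *\<^sub>R e)) \<bullet> e) has_field_derivative a * D + b * E) (at 0)"
    unfolding inner_add_left inner_scaleR_left using D E by (intro DERIV_add DERIV_cmult)
  then show "deriv (\<lambda>t. (a *\<^sub>R \<phi> (x + t *\<^sub>R e) + b *\<^sub>R \<psi> (x + t *\<^sub>R e)) \<bullet> e) 0 =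
      a * deriv (\<lambda>t. \<phi> (x + t *\<^sub>R e) \<bullet> e) 0 + b * deriv (\<lambda>t. \<psi> (x + t *\<^sub>R e) \<bullet> e) 0"
    using D E by (simp add: DERIV_imp_deriv)
qed

lemma divergence_bounded:
  fixes \<phi> :: "'a::euclidean_space \<Rightarrow> 'a"
  assumes lip: "C-lipschitz_on UNIV \<phi>" and "has_partials \<phi> x"
  shows "\<bar>divergence \<phi> x\<bar> \<le> real DIM('a) * C"
proof -
  have "\<bar>deriv (\<lambda>t. \<phi> (x + t *\<^sub>R b) \<bullet> b) 0\<bar> \<le> C" if b: "b \<in> Basis" for b
  proof -
    obtain D where D: "((\<lambda>t. \<phi> (x + t *\<^sub>R b) \<bullet> b) has_field_derivative D) (at 0)"
      using assms(2) b unfolding has_partials_def by blast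
    then have lim: "(\<lambda>h. \<bar>(\<phi> (x + (0 + h) *\<^sub>R b) \<bullet> b - \<phi> (x + 0 *\<^sub>R b) \<bullet> b) / h\<bar>) \<midarrow>0\<rightarrow> \<bar>D\<bar>"
      unfolding DERIV_def by (rule tendsto_rabs)
    have "\<bar>(\<phi> (x + (0 + h) *\<^sub>R b) \<bullet> b - \<phi> (x + 0 *\<^sub>R b) \<bullet> b) / h\<bar> \<le> C" if "h \<noteq> 0" for h
    proof -
      have "\<bar>\<phi> (x + (0 + h) *\<^sub>R b) \<bullet> b - \<phi> (x + 0 *\<^sub>R b) \<bullet> b\<bar> \<le> C * norm ((x + (0 + h) *\<^sub>R b) - (x + 0 *\<^sub>R b))"
        using lipschitz_on_normD[OF lipschitz_component[OF lip b], of "x + (0 + h) *\<^sub>R b" "x + 0 *\<^sub>R b"] by simp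
      also have "\<dots> = C * \<bar>h\<bar>" using b by simp
      finally show ?thesis using that by (simp add: divide_le_eq)
    qed
    then have "\<forall>\<^sub>F h in at 0. \<bar>(\<phi> (x + (0 + h) *\<^sub>R b) \<bullet> b - \<phi> (x + 0 *\<^sub>R b) \<bullet> b) / h\<bar> \<le> C"
      by (auto simp: eventually_at_filter)
    from tendsto_upperbound[OF lim this] show ?thesis using D by (simp add: DERIV_imp_deriv)
  qed
  then have "(\<Sum>b\<in>Basis. \<bar>deriv (\<lambda>t. \<phi> (x + t *\<^sub>R b) \<bullet> b) 0\<bar>) \<le> real DIM('a) * C"
    by (intro sum_bounded_above)
  then show ?thesis
    unfolding divergence_def by (intro order_trans[OF sum_abs]) simp
qed

text \<open>Almost everywhere the divergence is the pointwise limit of continuous difference quotients.\<close>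

lemma divergence_measurable:
  fixes \<phi> :: "'a::euclidean_space \<Rightarrow> 'a"
  assumes lip: "C-lipschitz_on UNIV \<phi>"
  shows "divergence \<phi> \<in> borel_measurable lebesgue"
proof -
  define q where "q b n x = (\<phi> (x + (1 / real (Suc n)) *\<^sub>R b) \<bullet> b - \<phi> x \<bullet> b) / (1 / real (Suc n))" for b x n
  define G where "G x = (\<Sum>b\<in>Basis. lim (\<lambda>n. q b n x))" for x
  have cont: "continuous_on UNIV \<phi>" using lip by (rule lipschitz_on_continuous_on)
  have "q b n \<in> borel_measurable borel" for b n
  proof -
    have "continuous_on UNIV (q b n)"
      unfolding q_def by (intro continuous_intros continuous_on_compose2[OF cont]) auto
    then show ?thesis by (rule borel_measurable_continuous_onI)
  qed
  then have "G \<in> borel_measurable borel"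
    unfolding G_def by (intro borel_measurable_sum borel_measurable_lim_metric)
  then have "G \<in> borel_measurable lebesgue"
    by (intro measurable_completion) simp
  moreover have "AE x in lebesgue. G x = divergence \<phi> x"
    using AE_has_partials[OF lip]
  proof eventually_elim
    case (elim x)
    have "lim (\<lambda>n. q b n x) = deriv (\<lambda>t. \<phi> (x + t *\<^sub>R b) \<bullet> b) 0" if b: "b \<in> Basis" for b
    proof -
      obtain D where D: "((\<lambda>t. \<phi> (x + t *\<^sub>R b) \<bullet> b) has_field_derivative D) (at 0)"
        using elim b unfolding has_partials_def by blast
      have "(\<lambda>n. 1 / real (Suc n)) \<longlonglongrightarrow> 0"
        by (rule LIMSEQ_Suc[OF lim_1_over_n])
      then have "filterlim (\<lambda>n. 1 / real (Suc n)) (at 0) sequentially"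
        by (auto simp: filterlim_at)
      from filterlim_compose[OF D[unfolded DERIV_def] this]
      have "(\<lambda>n. q b n x) \<longlonglongrightarrow> D" by (simp add: q_def)
      then show ?thesis using D by (simp add: limI DERIV_imp_deriv)
    qed
    then show ?case by (simp add: G_def divergence_def)
  qed
  ultimately show ?thesis by (rule borel_measurable_AE)
qed

text \<open>The integral extends over the whole space because the divergence of a test field vanishes off its support;
  in particular the values of \<open>f\<close> outside \<open>\<Omega>\<close> are multiplied by \<open>0\<close>.\<close>

definition pairing :: "('a::euclidean_space \<Rightarrow> real) \<Rightarrow> ('a \<Rightarrow> 'a) \<Rightarrow> real" where
  "pairing f \<phi> = (LINT x|lebesgue. f x * divergence \<phi> x)"

definition locally_integrable :: "'a::euclidean_space set \<Rightarrow> ('a \<Rightarrow> real) \<Rightarrow> bool" where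
  "locally_integrable \<Omega> f \<longleftrightarrow> (\<forall>K. compact K \<and> K \<subseteq> \<Omega> \<longrightarrow> set_integrable lebesgue K f)"

text \<open>The divergence is bounded almost everywhere and lives on a compact set, where \<open>f\<close> is integrable.\<close>

lemma integrable_pairing:
  fixes \<phi> :: "'a::euclidean_space \<Rightarrow> 'a"
  assumes f: "locally_integrable \<Omega> f" and \<phi>: "\<phi> \<in> test_fields \<Omega>"
  shows "integrable lebesgue (\<lambda>x. f x * divergence \<phi> x)"
proof -
  obtain C S where S: "C-lipschitz_on UNIV \<phi>" "compact S" "S \<subseteq> \<Omega>" "\<And>x. x \<notin> S \<Longrightarrow> \<phi> x = 0"
    using \<phi> unfolding test_fields_def by blast
  have int: "integrable lebesgue (\<lambda>x. indicator S x *\<^sub>R f x)"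
    using f S(2,3) unfolding locally_integrable_def set_integrable_def by blast
  have eq: "f x * divergence \<phi> x = (indicator S x *\<^sub>R f x) * divergence \<phi> x" for x
    using divergence_outside_support[OF S(2,4)] by (cases "x \<in> S") auto
  have "integrable lebesgue (\<lambda>x. (indicator S x *\<^sub>R f x) * divergence \<phi> x)"
  proof (rule Bochner_Integration.integrable_bound)
    show "integrable lebesgue (\<lambda>x. (real DIM('a) * C) * (indicator S x *\<^sub>R f x))"
      using int by (rule integrable_mult_right)
    show "(\<lambda>x. (indicator S x *\<^sub>R f x) * divergence \<phi> x) \<in> borel_measurable lebesgue"
      using borel_measurable_integrable[OF int] divergence_measurable[OF S(1)]
      by (rule borel_measurable_times)
    show "AE x in lebesgue. norm ((indicator S x *\<^sub>R f x) * divergence \<phi> x)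
        \<le> norm ((real DIM('a) * C) * (indicator S x *\<^sub>R f x))"
      using AE_has_partials[OF S(1)]
    proof eventually_elim
      case (elim x)
      have "\<bar>divergence \<phi> x\<bar> \<le> \<bar>real DIM('a) * C\<bar>"
        using divergence_bounded[OF S(1) elim] by simp
      then have "\<bar>indicator S x *\<^sub>R f x\<bar> * \<bar>divergence \<phi> x\<bar> \<le> \<bar>indicator S x *\<^sub>R f x\<bar> * \<bar>real DIM('a) * C\<bar>"
        by (rule mult_left_mono) auto
      then show ?case by (simp add: abs_mult mult_ac)
    qed
  qed
  then show ?thesis by (simp only: eq)
qed

lemma pairing_linear:
  assumes f: "locally_integrable \<Omega> f" and \<phi>: "\<phi> \<in> test_fields \<Omega>" and \<psi>: "\<psi> \<in> test_fields \<Omega>"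
  shows "pairing f (\<lambda>x. a *\<^sub>R \<phi> x + b *\<^sub>R \<psi> x) = a * pairing f \<phi> + b * pairing f \<psi>"
proof -
  obtain C where C: "C-lipschitz_on UNIV \<phi>" using \<phi> by (metis test_fieldsE)
  obtain D where D: "D-lipschitz_on UNIV \<psi>" using \<psi> by (metis test_fieldsE)
  note int = integrable_pairing[OF f]
  have "pairing f (\<lambda>x. a *\<^sub>R \<phi> x + b *\<^sub>R \<psi> x) =
      (LINT x|lebesgue. a * (f x * divergence \<phi> x) + b * (f x * divergence \<psi> x))"
    unfolding pairing_def
  proof (rule integral_cong_AE)
    show "AE x in lebesgue. f x * divergence (\<lambda>x. a *\<^sub>R \<phi> x + b *\<^sub>R \<psi> x) x =
        a * (f x * divergence \<phi> x) + b * (f x * divergence \<psi> x)"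
      using AE_has_partials[OF C] AE_has_partials[OF D]
      by eventually_elim (simp add: divergence_linear algebra_simps)
    show "(\<lambda>x. f x * divergence (\<lambda>x. a *\<^sub>R \<phi> x + b *\<^sub>R \<psi> x) x) \<in> borel_measurable lebesgue"
      by (intro borel_measurable_integrable int test_fields_linear \<phi> \<psi>)
    show "(\<lambda>x. a * (f x * divergence \<phi> x) + b * (f x * divergence \<psi> x)) \<in> borel_measurable lebesgue"
      by (intro borel_measurable_integrable Bochner_Integration.integrable_add integrable_mult_right int \<phi> \<psi>)
  qed
  also have "\<dots> = a * pairing f \<phi> + b * pairing f \<psi>"
    unfolding pairing_def using int[OF \<phi>] int[OF \<psi>] by simp
  finally show ?thesis .
qed

lemma pairing_zero [simp]: "pairing f (\<lambda>x. 0) = 0"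
  by (simp add: pairing_def)

lemma pairing_add:
  assumes "locally_integrable \<Omega> f" "\<phi> \<in> test_fields \<Omega>" "\<psi> \<in> test_fields \<Omega>"
  shows "pairing f (\<lambda>x. \<phi> x + \<psi> x) = pairing f \<phi> + pairing f \<psi>"
  using pairing_linear[OF assms, of 1 1] by simp

lemma pairing_scale:
  assumes "locally_integrable \<Omega> f" "\<phi> \<in> test_fields \<Omega>"
  shows "pairing f (\<lambda>x. a *\<^sub>R \<phi> x) = a * pairing f \<phi>"
  using pairing_linear[OF assms test_fields_zero, of a 0] by simp

definition admissible :: "('a::euclidean_space \<Rightarrow> ennreal) \<Rightarrow> 'a set \<Rightarrow> ('a \<Rightarrow> 'a) set" where
  "admissible w V = {\<phi> \<in> test_fields V. \<forall>x. ennreal (norm (\<phi> x)) \<le> w x}"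

text \<open>Extension by zero identifies admissible fields on \<open>V\<close> with admissible test fields, without changing
  the divergence on the open set \<open>V\<close>.\<close>

lemma weighted_variation_eq:
  assumes "open V"
  shows "weighted_variation w f V = (SUP \<phi>\<in>admissible w V. ennreal (pairing f \<phi>))"
proof (rule antisym)
  have set_eq: "(LINT x:V|lebesgue. f x * divergence \<phi> x) = pairing f \<psi>"
    if "\<psi> \<in> test_fields V" "\<And>x. x \<in> V \<Longrightarrow> \<phi> x = \<psi> x" for \<phi> \<psi>
    unfolding set_lebesgue_integral_def pairing_def
  proof (rule Bochner_Integration.integral_cong[OF refl])
    fix x
    obtain S where "compact S" "S \<subseteq> V" "\<And>x. x \<notin> S \<Longrightarrow> \<psi> x = 0"
      using \<open>\<psi> \<in> _\<close> by (metis test_fieldsE)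
    then have "divergence \<psi> x = 0" if "x \<notin> V"
      using divergence_outside_support[of S \<psi> x] that by blast
    then show "indicator V x *\<^sub>R (f x * divergence \<phi> x) = f x * divergence \<psi> x"
      using divergence_cong_open[OF \<open>open V\<close>, of x \<phi> \<psi>] that(2) by (cases "x \<in> V") auto
  qed
  show "weighted_variation w f V \<le> (SUP \<phi>\<in>admissible w V. ennreal (pairing f \<phi>))"
    unfolding weighted_variation_def
  proof (rule SUP_least, clarsimp)
    fix \<phi> assume \<phi>: "\<phi> \<in> Lip_c V" "\<forall>x\<in>V. ennreal (norm (\<phi> x)) \<le> w x"
    let ?\<psi> = "\<lambda>x. if x \<in> V then \<phi> x else 0"
    have "?\<psi> \<in> test_fields V" using \<open>open V\<close> \<phi>(1) by (rule Lip_c_extend_zero)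
    moreover from this have "?\<psi> \<in> admissible w V" using \<phi>(2) by (auto simp: admissible_def)
    ultimately show "ennreal (LINT x:V|lebesgue. f x * divergence \<phi> x) \<le>
        (SUP \<phi>\<in>admissible w V. ennreal (pairing f \<phi>))"
      by (intro SUP_upper2[of ?\<psi>] eq_refl arg_cong[of _ _ ennreal] set_eq) auto
  qed
  show "(SUP \<phi>\<in>admissible w V. ennreal (pairing f \<phi>)) \<le> weighted_variation w f V"
    unfolding weighted_variation_def
  proof (rule SUP_least)
    fix \<phi> assume "\<phi> \<in> admissible w V"
    then have \<phi>: "\<phi> \<in> test_fields V" "\<And>x. ennreal (norm (\<phi> x)) \<le> w x"
      by (auto simp: admissible_def)
    then show "ennreal (pairing f \<phi>) \<le> (SUP \<phi>\<in>{\<phi> \<in> Lip_c V. \<forall>x\<in>V. ennreal (norm (\<phi> x)) \<le> w x}.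
        ennreal (LINT x:V|lebesgue. f x * divergence \<phi> x))"
      using set_eq[of \<phi> \<phi>] test_fields_subset_Lip_c[OF \<phi>(1)]
      by (intro SUP_upper2[of \<phi>]) auto
  qed
qed

lemma zero_admissible: "(\<lambda>x. 0) \<in> admissible w V"
  by (simp add: admissible_def test_fields_zero)

section \<open>The variation as a measure\<close>

lemma SUP_add_SUP_le:
  fixes a :: "'i \<Rightarrow> ennreal" and b :: "'j \<Rightarrow> ennreal"
  assumes "A \<noteq> {}" "B \<noteq> {}" and le: "\<And>i j. i \<in> A \<Longrightarrow> j \<in> B \<Longrightarrow> a i + b j \<le> c"
  shows "(SUP i\<in>A. a i) + (SUP j\<in>B. b j) \<le> c"
proof -
  have "a i + (SUP j\<in>B. b j) \<le> c" if "i \<in> A" for i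
    unfolding ennreal_SUP_add_right[OF \<open>B \<noteq> {}\<close>] using le[OF that] by (rule SUP_least)
  then show ?thesis
    unfolding ennreal_SUP_add_left[OF \<open>A \<noteq> {}\<close>, symmetric] by (rule SUP_least)
qed

lemma ennreal_add_le_add: "ennreal (a + b) \<le> ennreal a + ennreal b"
  by (auto simp: ennreal_plus_if intro!: ennreal_leI)

lemma pairing_le_weighted_variation:
  assumes "open V" "\<phi> \<in> admissible w V"
  shows "ennreal (pairing f \<phi>) \<le> weighted_variation w f V"
  unfolding weighted_variation_eq[OF assms(1)] using assms(2) by (rule SUP_upper)

lemma weighted_variation_least:
  assumes "open V" "\<And>\<phi>. \<phi> \<in> admissible w V \<Longrightarrow> ennreal (pairing f \<phi>) \<le> c"
  shows "weighted_variation w f V \<le> c"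
  unfolding weighted_variation_eq[OF assms(1)] using assms(2) by (rule SUP_least)

lemma weighted_variation_mono:
  assumes "open V" "open V'" "V \<subseteq> V'" "\<And>x. x \<in> V \<Longrightarrow> w x \<le> w' x"
  shows "weighted_variation w f V \<le> weighted_variation w' f V'"
proof (rule weighted_variation_least[OF assms(1)])
  fix \<phi> assume "\<phi> \<in> admissible w V"
  then have \<phi>: "\<phi> \<in> test_fields V" "\<And>x. ennreal (norm (\<phi> x)) \<le> w x"
    by (auto simp: admissible_def)
  have "ennreal (norm (\<phi> x)) \<le> w' x" for x
    using \<phi>(2)[of x] assms(4)[of x] test_fields_zero_outside[OF \<phi>(1), of x]
    by (cases "x \<in> V") auto
  then have "\<phi> \<in> admissible w' V'"
    using \<phi>(1) test_fields_mono[OF assms(3)] by (auto simp: admissible_def)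
  with \<open>open V'\<close> show "ennreal (pairing f \<phi>) \<le> weighted_variation w' f V'"
    by (rule pairing_le_weighted_variation)
qed

lemma weighted_variation_empty: "weighted_variation w f {} = 0"
proof -
  have "pairing f \<phi> = 0" if "\<phi> \<in> test_fields {}" for \<phi>
  proof -
    have "\<phi> = (\<lambda>x. 0)" using test_fields_zero_outside[OF that] by auto
    then show ?thesis by simp
  qed
  then show ?thesis
    by (intro antisym weighted_variation_least) (auto simp: admissible_def)
qed

text \<open>The common core of superadditivity in the weight and on disjoint sets.  All three fields are required to be
  admissible because the coercion truncates negative pairings: if one summand is truncated, the bound
  comes from the other summand alone.\<close>

lemma ennreal_pairing_add_le:
  assumes "locally_integrable \<Omega> f" "V \<subseteq> \<Omega>" "open V"
    and "\<phi> \<in> admissible w V" "\<psi> \<in> admissible w V" "(\<lambda>x. \<phi> x + \<psi> x) \<in> admissible w V"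
  shows "ennreal (pairing f \<phi>) + ennreal (pairing f \<psi>) \<le> weighted_variation w f V"
proof (cases "0 \<le> pairing f \<phi> \<and> 0 \<le> pairing f \<psi>")
  case True
  have "\<phi> \<in> test_fields \<Omega>" "\<psi> \<in> test_fields \<Omega>"
    using assms(4,5) test_fields_mono[OF assms(2)] by (auto simp: admissible_def)
  then have "ennreal (pairing f \<phi>) + ennreal (pairing f \<psi>) = ennreal (pairing f (\<lambda>x. \<phi> x + \<psi> x))"
    using True pairing_add[OF assms(1)] by (simp add: ennreal_plus)
  then show ?thesis
    using pairing_le_weighted_variation[OF assms(3,6)] by simp
next
  case False
  then have "ennreal (pairing f \<phi>) = 0 \<or> ennreal (pairing f \<psi>) = 0"
    by (auto simp: ennreal_neg)
  then show ?thesis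
    using pairing_le_weighted_variation[OF assms(3,4)] pairing_le_weighted_variation[OF assms(3,5)] by auto
qed

text \<open>Admissible fields for \<open>u\<close> and \<open>v\<close> add up to an admissible field for \<open>u + v\<close>.\<close>

lemma weighted_variation_add_weights:
  assumes "locally_integrable \<Omega> f" "V \<subseteq> \<Omega>" "open V"
  shows "weighted_variation u f V + weighted_variation v f V \<le> weighted_variation (\<lambda>x. u x + v x) f V"
  unfolding weighted_variation_eq[OF assms(3), of u] weighted_variation_eq[OF assms(3), of v]
proof (rule SUP_add_SUP_le)
  fix \<phi> \<psi> assume "\<phi> \<in> admissible u V" "\<psi> \<in> admissible v V"
  then have *: "\<phi> \<in> test_fields V" "\<psi> \<in> test_fields V"
      "\<And>x. ennreal (norm (\<phi> x)) \<le> u x" "\<And>x. ennreal (norm (\<psi> x)) \<le> v x"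
    by (auto simp: admissible_def)
  have "ennreal (norm (\<phi> x + \<psi> x)) \<le> u x + v x" for x
  proof -
    have "ennreal (norm (\<phi> x + \<psi> x)) \<le> ennreal (norm (\<phi> x)) + ennreal (norm (\<psi> x))"
      by (simp add: ennreal_plus[symmetric] norm_triangle_ineq ennreal_leI del: ennreal_plus)
    then show ?thesis using add_mono[OF *(3,4)] order_trans by blast
  qed
  then have "(\<lambda>x. \<phi> x + \<psi> x) \<in> admissible (\<lambda>x. u x + v x) V"
    using test_fields_linear[OF *(1,2), of 1 1] by (simp add: admissible_def)
  moreover have "\<phi> \<in> admissible (\<lambda>x. u x + v x) V" "\<psi> \<in> admissible (\<lambda>x. u x + v x) V"
    using * by (auto simp: admissible_def intro: add_increasing add_increasing2)
  ultimately show "ennreal (pairing f \<phi>) + ennreal (pairing f \<psi>) \<le> weighted_variation (\<lambda>x. u x + v x) f V"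
    by (intro ennreal_pairing_add_le[OF assms])
qed (use zero_admissible in blast)+

text \<open>A field bounded by \<open>1\<close> and supported in \<open>U\<close>, multiplied by \<open>c\<close>, is admissible for the weight \<open>c 1\<^sub>U\<close>.\<close>

lemma weighted_variation_step_weight:
  assumes f: "locally_integrable \<Omega> f" "V \<subseteq> \<Omega>" and V: "open V" "open U" "U \<subseteq> V" and "0 \<le> c"
  shows "ennreal c * weighted_variation (\<lambda>_. 1) f U \<le> weighted_variation (\<lambda>x. ennreal c * indicator U x) f V"
  unfolding weighted_variation_eq[OF V(2)] SUP_mult_left_ennreal
proof (rule SUP_least)
  fix \<phi> :: "'a \<Rightarrow> 'a" assume "\<phi> \<in> admissible (\<lambda>_. 1) U"
  then have \<phi>: "\<phi> \<in> test_fields U" "\<And>x. norm (\<phi> x) \<le> 1"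
    by (auto simp: admissible_def)
  have cphi: "(\<lambda>x. c *\<^sub>R \<phi> x) \<in> test_fields U"
    using test_fields_linear[OF \<phi>(1) \<phi>(1), of c 0] by simp
  have "ennreal (norm (c *\<^sub>R \<phi> x)) \<le> ennreal c * indicator U x" for x
  proof (cases "x \<in> U")
    case True
    have "c * norm (\<phi> x) \<le> c" using \<phi>(2)[of x] \<open>0 \<le> c\<close> mult_left_le by blast
    then show ?thesis using True \<open>0 \<le> c\<close> by (simp add: ennreal_leI)
  qed (use test_fields_zero_outside[OF \<phi>(1)] in simp)
  then have "(\<lambda>x. c *\<^sub>R \<phi> x) \<in> admissible (\<lambda>x. ennreal c * indicator U x) V"
    using cphi test_fields_mono[OF V(3)] by (auto simp: admissible_def)
  from pairing_le_weighted_variation[OF V(1) this, of f]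
  have "ennreal (pairing f (\<lambda>x. c *\<^sub>R \<phi> x)) \<le> weighted_variation (\<lambda>x. ennreal c * indicator U x) f V" .
  moreover have "\<phi> \<in> test_fields \<Omega>"
    using \<phi>(1) test_fields_mono[of U \<Omega>] V(3) f(2) by blast
  ultimately show "ennreal c * ennreal (pairing f \<phi>) \<le> weighted_variation (\<lambda>x. ennreal c * indicator U x) f V"
    using pairing_scale[OF f(1), of \<phi> c] \<open>0 \<le> c\<close> by (simp add: ennreal_mult')
qed

lemma pairing_le_bound:
  assumes f: "locally_integrable \<Omega> f" "U \<subseteq> \<Omega>" "open U"
    and \<phi>: "\<phi> \<in> test_fields U" "\<And>x. norm (\<phi> x) \<le> c" and "0 < c"
  shows "ennreal (pairing f \<phi>) \<le> ennreal c * weighted_variation (\<lambda>_. 1) f U"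
proof -
  have \<phi>': "\<phi> \<in> test_fields \<Omega>" using \<phi>(1) test_fields_mono[OF f(2)] by auto
  have "(\<lambda>x. (1 / c) *\<^sub>R \<phi> x) \<in> test_fields U"
    using test_fields_linear[OF \<phi>(1) \<phi>(1), of "1/c" 0] by simp
  then have "(\<lambda>x. (1 / c) *\<^sub>R \<phi> x) \<in> admissible (\<lambda>_. 1) U"
    using \<phi>(2) \<open>0 < c\<close> by (simp add: admissible_def)
  from pairing_le_weighted_variation[OF f(3) this, of f]
  have "ennreal ((1 / c) * pairing f \<phi>) \<le> weighted_variation (\<lambda>_. 1) f U"
    by (simp only: pairing_scale[OF f(1) \<phi>'])
  then have "ennreal c * ennreal ((1 / c) * pairing f \<phi>) \<le> ennreal c * weighted_variation (\<lambda>_. 1) f U"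
    by (rule mult_left_mono) simp
  then show ?thesis using \<open>0 < c\<close> by (simp add: ennreal_mult'[symmetric])
qed

text \<open>Unless it is empty, the compact set \<open>A = K - V1\<close> has a closed \<open>e\<close>-neighbourhood inside \<open>V2\<close>.  The cutoff is a piecewise linear
  function of the distance to \<open>A\<close>: it is \<open>0\<close> within distance \<open>e / 2\<close> and \<open>1\<close> beyond distance \<open>e\<close>.\<close>

lemma lipschitz_cutoff:
  fixes K :: "'a::euclidean_space set"
  assumes K: "compact K" "K \<subseteq> V1 \<union> V2" and V: "open V1" "open V2"
  obtains D S1 S2 and \<eta> :: "'a \<Rightarrow> real" where "D-lipschitz_on UNIV \<eta>" "\<And>x. 0 \<le> \<eta> x" "\<And>x. \<eta> x \<le> 1"
    "compact S1" "S1 \<subseteq> V1" "compact S2" "S2 \<subseteq> V2"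
    "\<And>x. x \<in> K \<Longrightarrow> x \<notin> S1 \<Longrightarrow> \<eta> x = 0" "\<And>x. x \<in> K \<Longrightarrow> x \<notin> S2 \<Longrightarrow> \<eta> x = 1"
proof -
  define A where "A = K - V1"
  have A: "compact A" "A \<subseteq> V2" using K V by (auto simp: A_def compact_diff)
  show thesis
  proof (cases "A = {}")
    case True
    show thesis
      by (rule that[of 0 "\<lambda>x. 1" K "{}"]) (use K True in \<open>auto simp: A_def intro: lipschitz_intros\<close>)
  next
    case False
    obtain e where e: "e > 0" "{x. infdist x A \<le> e} \<subseteq> V2"
      using compact_in_open_separated[OF False A(1) V(2) A(2)] by blast
    define \<eta> where "\<eta> x = min 1 (max 0 (2 / e * infdist x A - 1))" for x
    have closed: "closed {x. e / 2 \<le> infdist x A}" "closed {x. infdist x A \<le> e}"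
      by (auto intro!: closed_Collect_le continuous_intros)
    show thesis
    proof (rule that[of "2 / e" \<eta> "K \<inter> {x. e / 2 \<le> infdist x A}" "K \<inter> {x. infdist x A \<le> e}"])
      show "(2 / e)-lipschitz_on UNIV \<eta>"
      proof (rule lipschitz_onI)
        fix x y
        have "\<bar>\<eta> x - \<eta> y\<bar> \<le> \<bar>2 / e * infdist x A - 2 / e * infdist y A\<bar>"
          unfolding \<eta>_def by (auto simp: min_def max_def)
        also have "\<dots> = \<bar>2 / e * (infdist x A - infdist y A)\<bar>"
          by (simp only: right_diff_distrib)
        also have "\<dots> = 2 / e * \<bar>infdist x A - infdist y A\<bar>"
          using e(1) by (subst abs_mult) simp
        also have "\<dots> \<le> 2 / e * dist x y"
          using e(1) infdist_triangle_abs by (intro mult_left_mono) auto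
        finally show "dist (\<eta> x) (\<eta> y) \<le> 2 / e * dist x y" by (simp add: dist_real_def)
      qed (use e in simp)
      show "K \<inter> {x. e / 2 \<le> infdist x A} \<subseteq> V1"
      proof
        fix x assume x: "x \<in> K \<inter> {x. e / 2 \<le> infdist x A}"
        then have "x \<notin> A" using e(1) by auto
        with x show "x \<in> V1" by (auto simp: A_def)
      qed
      show "\<eta> x = 0" if "x \<in> K" "x \<notin> K \<inter> {x. e / 2 \<le> infdist x A}" for x
        using that e(1) by (auto simp: \<eta>_def field_simps)
      show "\<eta> x = 1" if "x \<in> K" "x \<notin> K \<inter> {x. infdist x A \<le> e}" for x
        using that e(1) by (auto simp: \<eta>_def field_simps)
    qed (use closed K e in \<open>auto simp: \<eta>_def intro!: compact_Int_closed\<close>)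
  qed
qed

text \<open>A Lipschitz partition of unity splits an admissible field into admissible fields for the two sets.\<close>

lemma weighted_variation_Un_le:
  assumes f: "locally_integrable \<Omega> f" and V: "V1 \<union> V2 \<subseteq> \<Omega>" "open V1" "open V2"
  shows "weighted_variation w f (V1 \<union> V2) \<le> weighted_variation w f V1 + weighted_variation w f V2"
proof (rule weighted_variation_least)
  show "open (V1 \<union> V2)" using V by auto
  fix \<phi> assume "\<phi> \<in> admissible w (V1 \<union> V2)"
  then have \<phi>: "\<phi> \<in> test_fields (V1 \<union> V2)" "\<And>x. ennreal (norm (\<phi> x)) \<le> w x"
    by (auto simp: admissible_def)
  obtain S where S: "compact S" "S \<subseteq> V1 \<union> V2" "\<And>x. x \<notin> S \<Longrightarrow> \<phi> x = 0"
    using \<phi>(1) unfolding test_fields_def by blast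
  obtain D S1 S2 and \<eta> :: "'a \<Rightarrow> real" where \<eta>: "D-lipschitz_on UNIV \<eta>" "\<And>x. 0 \<le> \<eta> x" "\<And>x. \<eta> x \<le> 1"
    and S12: "compact S1" "S1 \<subseteq> V1" "compact S2" "S2 \<subseteq> V2"
    "\<And>x. x \<in> S \<Longrightarrow> x \<notin> S1 \<Longrightarrow> \<eta> x = 0" "\<And>x. x \<in> S \<Longrightarrow> x \<notin> S2 \<Longrightarrow> \<eta> x = 1"
    using lipschitz_cutoff[OF S(1,2) V(2,3)] by metis
  have lip': "D-lipschitz_on UNIV (\<lambda>x. 1 - \<eta> x)"
    using lipschitz_on_diff[OF lipschitz_on_constant \<eta>(1), of 1] by simp
  have t1: "(\<lambda>x. \<eta> x *\<^sub>R \<phi> x) \<in> test_fields V1"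
    using S12(5) S(3) by (intro test_fields_mult[OF \<phi>(1) \<eta>(1) _ S12(1,2)]) (use \<eta> in \<open>auto simp: abs_le_iff\<close>)
  have t2: "(\<lambda>x. (1 - \<eta> x) *\<^sub>R \<phi> x) \<in> test_fields V2"
    using S12(6) S(3) by (intro test_fields_mult[OF \<phi>(1) lip' _ S12(3,4)]) (use \<eta> in \<open>auto simp: abs_le_iff\<close>)
  have shrink: "ennreal (norm (t *\<^sub>R \<phi> x)) \<le> w x" if "0 \<le> t" "t \<le> 1" for t x
  proof -
    have "norm (t *\<^sub>R \<phi> x) \<le> norm (\<phi> x)"
      using that by (simp add: mult_left_le_one_le)
    then show ?thesis using \<phi>(2)[of x] by (meson ennreal_leI order_trans)
  qed
  have a1: "(\<lambda>x. \<eta> x *\<^sub>R \<phi> x) \<in> admissible w V1" and a2: "(\<lambda>x. (1 - \<eta> x) *\<^sub>R \<phi> x) \<in> admissible w V2"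
    using t1 t2 shrink \<eta> by (auto simp: admissible_def)
  have "pairing f \<phi> = pairing f (\<lambda>x. \<eta> x *\<^sub>R \<phi> x + (1 - \<eta> x) *\<^sub>R \<phi> x)"
    by (simp flip: scaleR_left_distrib)
  also have "\<dots> = pairing f (\<lambda>x. \<eta> x *\<^sub>R \<phi> x) + pairing f (\<lambda>x. (1 - \<eta> x) *\<^sub>R \<phi> x)"
    using t1 t2 test_fields_mono[of V1 \<Omega>] test_fields_mono[of V2 \<Omega>] V
    by (intro pairing_add[OF f]) auto
  finally have "ennreal (pairing f \<phi>) \<le>
      ennreal (pairing f (\<lambda>x. \<eta> x *\<^sub>R \<phi> x)) + ennreal (pairing f (\<lambda>x. (1 - \<eta> x) *\<^sub>R \<phi> x))"
    by (simp only: ennreal_add_le_add)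
  also have "\<dots> \<le> weighted_variation w f V1 + weighted_variation w f V2"
    using V a1 a2 by (intro add_mono pairing_le_weighted_variation)
  finally show "ennreal (pairing f \<phi>) \<le> weighted_variation w f V1 + weighted_variation w f V2" .
qed

lemma weighted_variation_UN_le_finite:
  assumes f: "locally_integrable \<Omega> f" and V: "\<And>n. open (V n)" "\<And>n. V n \<subseteq> \<Omega>"
  shows "weighted_variation w f (\<Union>n<N::nat. V n) \<le> (\<Sum>n<N. weighted_variation w f (V n))"
proof (induction N)
  case (Suc N)
  have "weighted_variation w f (\<Union>n<Suc N. V n) = weighted_variation w f ((\<Union>n<N. V n) \<union> V N)"
    by (simp add: lessThan_Suc Un_commute)
  also have "\<dots> \<le> weighted_variation w f (\<Union>n<N. V n) + weighted_variation w f (V N)"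
    using V by (intro weighted_variation_Un_le[OF f]) auto
  also have "\<dots> \<le> (\<Sum>n<N. weighted_variation w f (V n)) + weighted_variation w f (V N)"
    using Suc.IH by (intro add_mono) auto
  finally show ?case by simp
qed (simp add: weighted_variation_empty)

text \<open>The support of a field is compact, hence covered by finitely many of the sets, and the finite case
  applies.\<close>

lemma weighted_variation_UN_le:
  assumes f: "locally_integrable \<Omega> f" and V: "\<And>n::nat. open (V n)" "\<And>n. V n \<subseteq> \<Omega>"
  shows "weighted_variation w f (\<Union>n. V n) \<le> (\<Sum>n. weighted_variation w f (V n))"
proof (rule weighted_variation_least)
  show "open (\<Union>n. V n)" using V by auto
  fix \<phi> assume "\<phi> \<in> admissible w (\<Union>n. V n)"
  then have \<phi>: "\<phi> \<in> test_fields (\<Union>n. V n)" "\<And>x. ennreal (norm (\<phi> x)) \<le> w x"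
    by (auto simp: admissible_def)
  obtain C S where S: "C-lipschitz_on UNIV \<phi>" "compact S" "S \<subseteq> (\<Union>n. V n)" "\<And>x. x \<notin> S \<Longrightarrow> \<phi> x = 0"
    using \<phi>(1) unfolding test_fields_def by blast
  obtain I where I: "finite I" "S \<subseteq> (\<Union>n\<in>I. V n)"
    using compactE_image[OF S(2), of UNIV V] V(1) S(3) by auto
  obtain N where "I \<subseteq> {..<N}" using finite_nat_bounded[OF I(1)] by blast
  then have "S \<subseteq> (\<Union>n<N. V n)" using I(2) by blast
  then have "\<phi> \<in> admissible w (\<Union>n<N. V n)"
    using \<phi>(2) test_fieldsI[OF S(1,2)] S(4) by (auto simp: admissible_def)
  then have "ennreal (pairing f \<phi>) \<le> weighted_variation w f (\<Union>n<N. V n)"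
    using V by (intro pairing_le_weighted_variation) auto
  also have "\<dots> \<le> (\<Sum>n<N. weighted_variation w f (V n))"
    by (rule weighted_variation_UN_le_finite[OF f V])
  also have "\<dots> \<le> (\<Sum>n. weighted_variation w f (V n))"
    by (intro sum_le_suminf) auto
  finally show "ennreal (pairing f \<phi>) \<le> (\<Sum>n. weighted_variation w f (V n))" .
qed

text \<open>The set function inside \<open>variation_measure\<close>, named so that Caratheodory's construction can be applied
  to it.\<close>

definition outer_variation :: "'a::euclidean_space set \<Rightarrow> ('a \<Rightarrow> real) \<Rightarrow> 'a set \<Rightarrow> ennreal" where
  "outer_variation \<Omega> f A = (INF V\<in>{V. open V \<and> A \<subseteq> V \<and> V \<subseteq> \<Omega>}. weighted_variation (\<lambda>_. 1) f V)"

lemma outer_variation_open: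
  assumes "open V" "V \<subseteq> \<Omega>"
  shows "outer_variation \<Omega> f V = weighted_variation (\<lambda>_. 1) f V"
  unfolding outer_variation_def
proof (rule antisym)
  show "(INF W\<in>{W. open W \<and> V \<subseteq> W \<and> W \<subseteq> \<Omega>}. weighted_variation (\<lambda>_. 1) f W) \<le> weighted_variation (\<lambda>_. 1) f V"
    using assms by (intro INF_lower) auto
  show "weighted_variation (\<lambda>_. 1) f V \<le> (INF W\<in>{W. open W \<and> V \<subseteq> W \<and> W \<subseteq> \<Omega>}. weighted_variation (\<lambda>_. 1) f W)"
    using assms by (intro INF_greatest weighted_variation_mono) auto
qed

lemma outer_variation_le:
  "open V \<Longrightarrow> A \<subseteq> V \<Longrightarrow> V \<subseteq> \<Omega> \<Longrightarrow> outer_variation \<Omega> f A \<le> weighted_variation (\<lambda>_. 1) f V"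
  unfolding outer_variation_def by (intro INF_lower) auto

lemma outer_measure_space_outer_variation:
  assumes f: "locally_integrable \<Omega> f"
  shows "outer_measure_space (Pow \<Omega>) (outer_variation \<Omega> f)"
  unfolding outer_measure_space_def
proof (intro conjI)
  show "positive (Pow \<Omega>) (outer_variation \<Omega> f)"
    by (simp add: positive_def outer_variation_open weighted_variation_empty)
  show "increasing (Pow \<Omega>) (outer_variation \<Omega> f)"
    unfolding increasing_def outer_variation_def by (auto intro!: INF_superset_mono)
  show "countably_subadditive (Pow \<Omega>) (outer_variation \<Omega> f)"
    unfolding countably_subadditive_def
  proof (intro allI impI)
    fix A :: "nat \<Rightarrow> 'a set"
    show "outer_variation \<Omega> f (\<Union>i. A i) \<le> (\<Sum>i. outer_variation \<Omega> f (A i))"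
    proof (rule ennreal_le_epsilon)
      fix e :: real
      assume "0 < e" and fin: "(\<Sum>i. outer_variation \<Omega> f (A i)) < top"
      have "\<exists>V. open V \<and> A n \<subseteq> V \<and> V \<subseteq> \<Omega> \<and>
          weighted_variation (\<lambda>_. 1) f V < outer_variation \<Omega> f (A n) + ennreal (e * (1/2)^Suc n)" for n
      proof -
        have "outer_variation \<Omega> f (A n) < outer_variation \<Omega> f (A n) + ennreal (e * (1/2)^Suc n)"
          using fin \<open>0 < e\<close> by (auto simp add: less_top dest!: ennreal_suminf_lessD)
        then show ?thesis
          unfolding outer_variation_def[of \<Omega> f "A n"] INF_less_iff by blast
      qed
      then obtain V where V: "\<And>n. open (V n)" "\<And>n. A n \<subseteq> V n" "\<And>n. V n \<subseteq> \<Omega>"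
          "\<And>n. weighted_variation (\<lambda>_. 1) f (V n) < outer_variation \<Omega> f (A n) + ennreal (e * (1/2)^Suc n)"
        by metis
      have "outer_variation \<Omega> f (\<Union>i. A i) \<le> weighted_variation (\<lambda>_. 1) f (\<Union>n. V n)"
        using V by (intro outer_variation_le) blast+
      also have "\<dots> \<le> (\<Sum>n. weighted_variation (\<lambda>_. 1) f (V n))"
        by (rule weighted_variation_UN_le[OF f V(1,3)])
      also have "\<dots> \<le> (\<Sum>n. outer_variation \<Omega> f (A n) + ennreal (e * (1/2)^Suc n))"
        using V(4) by (intro suminf_le) (auto intro: less_imp_le)
      also have "\<dots> = (\<Sum>n. outer_variation \<Omega> f (A n)) + (\<Sum>n. ennreal (e * (1/2)^Suc n))"
        by (intro suminf_add[symmetric]) auto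
      also have "(\<Sum>n. ennreal (e * (1/2)^Suc n)) = ennreal (e * 1)"
        using \<open>0 < e\<close> by (intro suminf_ennreal_eq sums_mult power_half_series) auto
      finally show "outer_variation \<Omega> f (\<Union>i. A i) \<le> (\<Sum>i. outer_variation \<Omega> f (A i)) + ennreal e"
        by simp
    qed
  qed
qed

text \<open>Only superadditivity requires work.  For an open \<open>V\<close> that contains \<open>A\<close>, consider a field \<open>\<phi>\<close> on
  \<open>V \<inter> U\<close> with compact support \<open>S\<close>.  The open set \<open>V - S\<close> still contains \<open>A - U\<close>, and any field \<open>\<psi>\<close> on it
  has support disjoint from that of \<open>\<phi>\<close>, so \<open>\<phi> + \<psi>\<close> remains bounded by \<open>1\<close>.  It remains to pass to the supremum over \<open>\<psi>\<close>, then over \<open>\<phi>\<close>.\<close>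

lemma open_caratheodory_measurable:
  assumes f: "locally_integrable \<Omega> f" and U: "open U" "U \<subseteq> \<Omega>"
  shows "U \<in> lambda_system \<Omega> (Pow \<Omega>) (outer_variation \<Omega> f)"
proof -
  interpret sigma_algebra \<Omega> "Pow \<Omega>" by (rule sigma_algebra_Pow)
  let ?\<nu> = "outer_variation \<Omega> f"
  have oms: "outer_measure_space (Pow \<Omega>) ?\<nu>" by (rule outer_measure_space_outer_variation[OF f])
  have "?\<nu> (A \<inter> U) + ?\<nu> (A - U) = ?\<nu> A" if "A \<subseteq> \<Omega>" for A
  proof (rule antisym)
    have "subadditive (Pow \<Omega>) ?\<nu>"
      using oms unfolding outer_measure_space_def by (intro countably_subadditive_subadditive) auto
    then have "?\<nu> ((A \<inter> U) \<union> (A - U)) \<le> ?\<nu> (A \<inter> U) + ?\<nu> (A - U)"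
      by (rule subadditiveD) (use that in auto)
    then show "?\<nu> A \<le> ?\<nu> (A \<inter> U) + ?\<nu> (A - U)" by (simp add: Int_Diff_Un)
    show "?\<nu> (A \<inter> U) + ?\<nu> (A - U) \<le> ?\<nu> A"
      unfolding outer_variation_def[of \<Omega> f A]
    proof (rule INF_greatest)
      fix V assume "V \<in> {V. open V \<and> A \<subseteq> V \<and> V \<subseteq> \<Omega>}"
      then have V: "open V" "A \<subseteq> V" "V \<subseteq> \<Omega>" by auto
      have "?\<nu> (A \<inter> U) \<le> weighted_variation (\<lambda>_. 1) f (V \<inter> U)"
        using V U by (intro outer_variation_le) auto
      also have "\<dots> = (SUP \<phi>\<in>admissible (\<lambda>_. 1) (V \<inter> U). ennreal (pairing f \<phi>))"
        using V U by (intro weighted_variation_eq) auto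
      finally have "?\<nu> (A \<inter> U) + ?\<nu> (A - U) \<le>
          (SUP \<phi>\<in>admissible (\<lambda>_. 1) (V \<inter> U). ennreal (pairing f \<phi>)) + ?\<nu> (A - U)"
        by (rule add_right_mono)
      also have "\<dots> = (SUP \<phi>\<in>admissible (\<lambda>_. 1) (V \<inter> U). ennreal (pairing f \<phi>) + ?\<nu> (A - U))"
        using zero_admissible by (intro ennreal_SUP_add_left[symmetric]) blast
      also have "\<dots> \<le> weighted_variation (\<lambda>_. 1) f V"
      proof (rule SUP_least)
        fix \<phi> :: "'a \<Rightarrow> 'a" assume \<phi>: "\<phi> \<in> admissible (\<lambda>_. 1) (V \<inter> U)"
        then obtain S where S: "compact S" "S \<subseteq> V \<inter> U" "\<And>x. x \<notin> S \<Longrightarrow> \<phi> x = 0"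
          unfolding admissible_def test_fields_def by blast
        have op: "open (V - S)" using V S(1) by (simp add: compact_imp_closed open_Diff)
        have "?\<nu> (A - U) \<le> weighted_variation (\<lambda>_. 1) f (V - S)"
          using V S op by (intro outer_variation_le) auto
        then have "ennreal (pairing f \<phi>) + ?\<nu> (A - U) \<le>
            ennreal (pairing f \<phi>) + (SUP \<psi>\<in>admissible (\<lambda>_. 1) (V - S). ennreal (pairing f \<psi>))"
          unfolding weighted_variation_eq[OF op] by (rule add_left_mono)
        also have "\<dots> = (SUP \<psi>\<in>admissible (\<lambda>_. 1) (V - S). ennreal (pairing f \<phi>) + ennreal (pairing f \<psi>))"
          using zero_admissible by (intro ennreal_SUP_add_right) blast
        also have "\<dots> \<le> weighted_variation (\<lambda>_. 1) f V"
        proof (rule SUP_least)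
          fix \<psi> :: "'a \<Rightarrow> 'a" assume \<psi>: "\<psi> \<in> admissible (\<lambda>_. 1) (V - S)"
          have a: "\<phi> \<in> admissible (\<lambda>_. 1) V" "\<psi> \<in> admissible (\<lambda>_. 1) V"
            using \<phi> \<psi> test_fields_mono[of "V \<inter> U" V] test_fields_mono[of "V - S" V]
            by (auto simp: admissible_def)
          have "norm (\<phi> x + \<psi> x) \<le> 1" for x
          proof (cases "x \<in> S")
            case True
            then have "\<psi> x = 0" using \<psi> test_fields_zero_outside[of \<psi> "V - S"] by (auto simp: admissible_def)
            then show ?thesis using a(1) by (simp add: admissible_def)
          next
            case False
            then show ?thesis using S(3) a(2) by (simp add: admissible_def)
          qed
          then have "(\<lambda>x. \<phi> x + \<psi> x) \<in> admissible (\<lambda>_. 1) V"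
            using a test_fields_linear[of \<phi> V \<psi> 1 1] by (simp add: admissible_def)
          with a show "ennreal (pairing f \<phi>) + ennreal (pairing f \<psi>) \<le> weighted_variation (\<lambda>_. 1) f V"
            by (rule ennreal_pairing_add_le[OF f V(3,1)])
        qed
        finally show "ennreal (pairing f \<phi>) + ?\<nu> (A - U) \<le> weighted_variation (\<lambda>_. 1) f V" .
      qed
      finally show "?\<nu> (A \<inter> U) + ?\<nu> (A - U) \<le> weighted_variation (\<lambda>_. 1) f V" .
    qed
  qed
  then show ?thesis using U(2) by (auto simp: lambda_system_eq)
qed

text \<open>Open subsets of \<open>\<Omega>\<close> are Caratheodory measurable, hence so are all Borel subsets.\<close>

lemma measure_space_outer_variation:
  assumes f: "locally_integrable \<Omega> f" and "open \<Omega>"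
  shows "measure_space \<Omega> {A \<in> sets borel. A \<subseteq> \<Omega>} (outer_variation \<Omega> f)"
proof -
  interpret P: sigma_algebra \<Omega> "Pow \<Omega>" by (rule sigma_algebra_Pow)
  let ?L = "lambda_system \<Omega> (Pow \<Omega>) (outer_variation \<Omega> f)"
  have ms: "measure_space \<Omega> ?L (outer_variation \<Omega> f)"
    by (intro P.caratheodory_lemma outer_measure_space_outer_variation f)
  then interpret L: sigma_algebra \<Omega> ?L by (simp add: measure_space_def)
  have "A \<inter> \<Omega> \<in> ?L" if "A \<in> sets borel" for A
  proof -
    from that have "A \<in> sigma_sets UNIV {S. open S}" by (simp add: borel_def)
    then show ?thesis
    proof induction
      case (Basic a)
      then show ?case using \<open>open \<Omega>\<close> by (intro open_caratheodory_measurable f) auto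
    next
      case (Compl a)
      have "(UNIV - a) \<inter> \<Omega> = \<Omega> - (a \<inter> \<Omega>)" by blast
      then show ?case using Compl by auto
    next
      case (Union a)
      then have "(\<Union>i. a i \<inter> \<Omega>) \<in> ?L" by (intro L.countable_UN) auto
      then show ?case by simp
    qed simp
  qed
  then have sub: "{A \<in> sets borel. A \<subseteq> \<Omega>} \<subseteq> ?L" by (metis (no_types, lifting) Int_absorb2 mem_Collect_eq subsetI)
  have "sigma_algebra \<Omega> {A \<in> sets borel. A \<subseteq> \<Omega>}"
  proof -
    have "{A \<in> sets borel. A \<subseteq> \<Omega>} = sets (restrict_space borel \<Omega>)"
      using \<open>open \<Omega>\<close> by (auto simp: sets_restrict_space_iff)
    moreover have "space (restrict_space borel \<Omega>) = \<Omega>" by (simp add: space_restrict_space)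
    ultimately show ?thesis using sets.sigma_algebra_axioms[of "restrict_space borel \<Omega>"] by simp
  qed
  then show ?thesis using measure_down[OF ms _ sub] by blast
qed

lemma variation_measure_alt:
  "variation_measure \<Omega> f = measure_of \<Omega> {A \<in> sets borel. A \<subseteq> \<Omega>} (outer_variation \<Omega> f)"
  by (simp add: variation_measure_def outer_variation_def[abs_def])

lemma space_variation_measure [simp]: "space (variation_measure \<Omega> f) = \<Omega>"
  by (simp add: variation_measure_alt space_measure_of_conv)

lemma sets_variation_measure:
  assumes "locally_integrable \<Omega> f" "open \<Omega>"
  shows "sets (variation_measure \<Omega> f) = {A \<in> sets borel. A \<subseteq> \<Omega>}"
proof -
  have "sigma_algebra \<Omega> {A \<in> sets borel. A \<subseteq> \<Omega>}"
    using measure_space_outer_variation[OF assms] by (simp add: measure_space_def)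
  from sigma_algebra.sigma_sets_eq[OF this] show ?thesis
    unfolding variation_measure_alt by (subst sets_measure_of) auto
qed

lemma emeasure_variation_measure_open:
  assumes "locally_integrable \<Omega> f" "open \<Omega>" "open V" "V \<subseteq> \<Omega>"
  shows "emeasure (variation_measure \<Omega> f) V = weighted_variation (\<lambda>_. 1) f V"
proof -
  have "emeasure (variation_measure \<Omega> f) V = outer_variation \<Omega> f V"
    using measure_space_outer_variation[OF assms(1,2)] sets_variation_measure[OF assms(1,2)] assms(3,4)
    by (intro emeasure_measure_of[OF variation_measure_alt]) (auto simp: measure_space_def)
  then show ?thesis using assms by (simp add: outer_variation_open)
qed

section \<open>The integral of the weight is a lower bound\<close>

lemma open_superlevel_lsc:
  assumes "lower_semicontinuous w"
  shows "open {x. t < w x}"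
proof (subst open_subopen, intro ballI)
  fix x assume "x \<in> {x. t < w x}"
  then have "\<forall>\<^sub>F y in nhds x. t < w y" using assms unfolding lower_semicontinuous_def by blast
  then show "\<exists>T. open T \<and> x \<in> T \<and> T \<subseteq> {x. t < w x}"
    unfolding eventually_nhds by (metis mem_Collect_eq subsetI)
qed

text \<open>Up to the factor \<open>\<epsilon>\<close> the staircase counts how many of the first \<open>N\<close> positive multiples of \<open>\<epsilon>\<close> lie below \<open>w x\<close>.  If the last
  step is present, the whole sum is at most \<open>Suc N\<close> times \<open>\<epsilon>\<close>, which is below \<open>w x\<close>; otherwise it is a
  shorter staircase.\<close>

lemma staircase_le:
  fixes w :: "'a \<Rightarrow> ennreal"
  assumes "0 \<le> \<epsilon>"
  shows "(\<Sum>k<N. ennreal \<epsilon> * indicator {x. ennreal (real (Suc k) * \<epsilon>) < w x} x) \<le> w x"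
proof (induction N)
  case (Suc N)
  show ?case
  proof (cases "ennreal (real (Suc N) * \<epsilon>) < w x")
    case True
    have "(\<Sum>k<Suc N. ennreal \<epsilon> * indicator {x. ennreal (real (Suc k) * \<epsilon>) < w x} x)
        \<le> (\<Sum>k<Suc N. ennreal \<epsilon>)"
      by (intro sum_mono) (auto simp: indicator_def)
    also have "\<dots> = ennreal (real (Suc N) * \<epsilon>)"
      using assms by (simp add: ennreal_mult ennreal_of_nat_eq_real_of_nat del: of_nat_Suc)
    finally show ?thesis using True by simp
  qed (use Suc.IH in simp)
qed simp

text \<open>If \<open>w x\<close> exceeds \<open>j \<epsilon>\<close>, the first \<open>j\<close> steps of the staircase are all present.\<close>

lemma staircase_ge:
  fixes w :: "'a \<Rightarrow> ennreal"
  assumes "0 \<le> \<epsilon>" "j \<le> N" "ennreal (real j * \<epsilon>) < w x"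
  shows "ennreal (real j * \<epsilon>) \<le> (\<Sum>k<N. ennreal \<epsilon> * indicator {x. ennreal (real (Suc k) * \<epsilon>) < w x} x)"
proof -
  have "ennreal (real j * \<epsilon>) = (\<Sum>k<j. ennreal \<epsilon>)"
    using assms(1) by (simp add: ennreal_mult ennreal_of_nat_eq_real_of_nat)
  also have "\<dots> = (\<Sum>k<j. ennreal \<epsilon> * indicator {x. ennreal (real (Suc k) * \<epsilon>) < w x} x)"
  proof (rule sum.cong[OF refl])
    fix k assume "k \<in> {..<j}"
    then have "real (Suc k) * \<epsilon> \<le> real j * \<epsilon>"
      using assms(1) by (intro mult_right_mono) auto
    then have "ennreal (real (Suc k) * \<epsilon>) < w x"
      using assms(3) by (meson ennreal_leI le_less_trans)
    then show "ennreal \<epsilon> = ennreal \<epsilon> * indicator {x. ennreal (real (Suc k) * \<epsilon>) < w x} x" by simp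
  qed
  also have "\<dots> \<le> (\<Sum>k<N. ennreal \<epsilon> * indicator {x. ennreal (real (Suc k) * \<epsilon>) < w x} x)"
    using assms(2) by (intro sum_mono2) auto
  finally show ?thesis .
qed

lemma weighted_variation_staircase:
  assumes f: "locally_integrable \<Omega> f" "V \<subseteq> \<Omega>" and V: "open V" "\<And>k. open (U k)" "\<And>k. U k \<subseteq> V" and "0 \<le> \<epsilon>"
  shows "(\<Sum>k<N::nat. ennreal \<epsilon> * weighted_variation (\<lambda>_. 1) f (U k))
      \<le> weighted_variation (\<lambda>x. \<Sum>k<N. ennreal \<epsilon> * indicator (U k) x) f V"
proof (induction N)
  case (Suc N)
  have "(\<Sum>k<Suc N. ennreal \<epsilon> * weighted_variation (\<lambda>_. 1) f (U k)) \<le>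
      weighted_variation (\<lambda>x. \<Sum>k<N. ennreal \<epsilon> * indicator (U k) x) f V
      + weighted_variation (\<lambda>x. ennreal \<epsilon> * indicator (U N) x) f V"
    unfolding sum.lessThan_Suc
    by (intro add_mono Suc.IH weighted_variation_step_weight[OF f V(1)] V \<open>0 \<le> \<epsilon>\<close>)
  also have "\<dots> \<le> weighted_variation (\<lambda>x. (\<Sum>k<N. ennreal \<epsilon> * indicator (U k) x) + ennreal \<epsilon> * indicator (U N) x) f V"
    by (rule weighted_variation_add_weights[OF f V(1)])
  finally show ?case by simp
qed simp

lemma measurable_variation_measure_lsc:
  fixes w :: "'a::euclidean_space \<Rightarrow> ennreal"
  assumes "locally_integrable \<Omega> f" "open \<Omega>" "lower_semicontinuous w"
  shows "w \<in> borel_measurable (variation_measure \<Omega> f)"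
proof (rule borel_measurableI_greater)
  fix y
  have "{x \<in> \<Omega>. y < w x} = \<Omega> \<inter> {x. y < w x}" by auto
  then show "{x \<in> space (variation_measure \<Omega> f). y < w x} \<in> sets (variation_measure \<Omega> f)"
    using open_superlevel_lsc[OF assms(3)] \<open>open \<Omega>\<close>
    by (auto simp: sets_variation_measure[OF assms(1,2)])
qed

text \<open>Staircases of step \<open>1 / m\<close> with \<open>m\<^sup>2\<close> steps reach height \<open>m\<close>, so their lower limit dominates \<open>w\<close>
  everywhere, including points with \<open>w x = \<infinity>\<close>.  Their integrals are sums of variations of open sets,
  and Fatou's lemma passes the bound to the limit.\<close>

lemma nn_integral_le_weighted_variation:
  assumes f: "locally_integrable \<Omega> f" and \<Omega>: "open \<Omega>" and V: "open V" "V \<subseteq> \<Omega>"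
    and lsc: "lower_semicontinuous w"
  shows "(\<integral>\<^sup>+x\<in>V. w x \<partial>variation_measure \<Omega> f) \<le> weighted_variation w f V"
proof -
  let ?\<mu> = "variation_measure \<Omega> f"
  define \<epsilon> where "\<epsilon> m = 1 / real (Suc m)" for m
  define U where "U m k = V \<inter> {x. ennreal (real (Suc k) * \<epsilon> m) < w x}" for m k
  define S where "S m x = (\<Sum>k<Suc m * Suc m. ennreal (\<epsilon> m) * indicator (U m k) x)" for m x
  have \<epsilon>: "0 < \<epsilon> m" for m by (simp add: \<epsilon>_def)
  have U: "open (U m k)" "U m k \<subseteq> V" for m k
    using V(1) open_superlevel_lsc[OF lsc] by (auto simp: U_def)
  have U_sub: "U m k \<subseteq> \<Omega>" for m k
    using U(2) V(2) by (rule subset_trans)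
  have U_sets: "U m k \<in> sets ?\<mu>" for m k
    using U[of m k] V by (auto simp: sets_variation_measure[OF f \<Omega>])
  have S_eq: "S m x = (\<Sum>k<Suc m * Suc m. ennreal (\<epsilon> m) * indicator {x. ennreal (real (Suc k) * \<epsilon> m) < w x} x)"
    if "x \<in> V" for m x
    using that unfolding S_def U_def by (intro sum.cong) (auto simp: indicator_def)
  have le: "(\<integral>\<^sup>+x. S m x \<partial>?\<mu>) \<le> weighted_variation w f V" for m
  proof -
    have "(\<integral>\<^sup>+x. S m x \<partial>?\<mu>) = (\<Sum>k<Suc m * Suc m. ennreal (\<epsilon> m) * emeasure ?\<mu> (U m k))"
      unfolding S_def using U_sets by (subst nn_integral_sum) (auto simp: nn_integral_cmult_indicator)
    also have "\<dots> = (\<Sum>k<Suc m * Suc m. ennreal (\<epsilon> m) * weighted_variation (\<lambda>_. 1) f (U m k))"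
      by (simp only: emeasure_variation_measure_open[OF f \<Omega> U(1) U_sub])
    also have "\<dots> \<le> weighted_variation (S m) f V"
      unfolding S_def[abs_def] using \<epsilon>[of m] by (intro weighted_variation_staircase[OF f V(2,1) U]) auto
    also have "\<dots> \<le> weighted_variation w f V"
    proof (rule weighted_variation_mono[OF V(1) V(1) order_refl])
      fix x assume "x \<in> V"
      then show "S m x \<le> w x"
        using staircase_le[where \<epsilon>="\<epsilon> m" and N="Suc m * Suc m" and w=w and x=x] \<epsilon>[of m] by (simp only: S_eq less_imp_le)
    qed
    finally show ?thesis .
  qed
  have "(\<integral>\<^sup>+x\<in>V. w x \<partial>?\<mu>) \<le> (\<integral>\<^sup>+x. liminf (\<lambda>m. S m x) \<partial>?\<mu>)"
  proof (rule nn_integral_mono)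
    fix x
    show "w x * indicator V x \<le> liminf (\<lambda>m. S m x)"
    proof (cases "x \<in> V")
      case True
      have "\<forall>\<^sub>F m in sequentially. y < S m x" if yw: "y < w x" for y
      proof -
        obtain z where z: "y < z" "z < w x" using dense[OF yw] by blast
        obtain z' where z': "z < z'" "z' < w x" using dense[OF z(2)] by blast
        obtain t t' where t: "0 \<le> t" "z = ennreal t" "0 \<le> t'" "z' = ennreal t'"
          using z z' by (metis ennreal_cases less_top_ennreal not_less_iff_gr_or_eq order_less_trans top_greatest linorder_not_le)
        have "t < t'" using z' t by (simp add: ennreal_less_iff)
        obtain n :: nat where n: "1 / (t' - t) < n" "t + 1 < n"
          using reals_Archimedean2[of "max (1 / (t' - t)) (t + 1)"] by auto
        have "y < S m x" if "m \<ge> n" for m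
        proof -
          define M where "M = real (Suc m)"
          have M: "1 / (t' - t) < M" "t + 1 < M" "0 < M" "\<epsilon> m = 1 / M"
            using n that by (auto simp: M_def \<epsilon>_def)
          \<comment> \<open>The staircase reaches the first multiple of \<open>1 / M\<close> above \<open>t\<close>, which is still below \<open>t'\<close>.\<close>
          define j where "j = nat \<lceil>t * M\<rceil>"
          have j: "t * M \<le> real j" "real j < t * M + 1"
            using t(1) M(3) by (auto simp: j_def of_nat_nat) linarith+
          have tM: "t \<le> real j * \<epsilon> m"
            using j(1) M(3) by (simp add: M(4) pos_le_divide_eq)
          have "1 < (t' - t) * M" using M(1,3) \<open>t < t'\<close> by (simp add: field_simps)
          then have "real j < t' * M" using j(2) by (simp add: algebra_simps)
          then have jt': "real j * \<epsilon> m < t'" using M(3) by (simp add: M(4) pos_divide_less_eq)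
          have "t * M + 1 \<le> t * M + M" using n that t(1) M(2) by auto
          also have "\<dots> = (t + 1) * M" by (simp add: algebra_simps)
          also have "\<dots> \<le> M * M" using M by (intro mult_right_mono) auto
          finally have "real j < M * M" using j(2) by linarith
          also have "M * M = real (Suc m * Suc m)" unfolding M_def by (rule of_nat_mult[symmetric])
          finally have "j \<le> Suc m * Suc m" by (simp only: of_nat_less_iff less_imp_le)
          moreover have "ennreal (real j * \<epsilon> m) < w x"
            using jt' z'(2) t by (meson ennreal_leI less_imp_le order_le_less_trans)
          ultimately have "ennreal (real j * \<epsilon> m) \<le> S m x"
            unfolding S_eq[OF True] using \<epsilon>[of m] by (intro staircase_ge) auto
          moreover have "ennreal t \<le> ennreal (real j * \<epsilon> m)" using tM by (rule ennreal_leI)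
          ultimately show "y < S m x" using z(1) t(2) by (metis order_less_le_trans order_trans)
        qed
        then show ?thesis by (auto simp: eventually_sequentially)
      qed
      then show ?thesis using True by (simp add: le_Liminf_iff)
    qed simp
  qed
  also have "\<dots> \<le> liminf (\<lambda>m. \<integral>\<^sup>+x. S m x \<partial>?\<mu>)"
  proof (rule nn_integral_liminf)
    show "S m \<in> borel_measurable ?\<mu>" for m
      unfolding S_def[abs_def] using U_sets by (intro borel_measurable_sum borel_measurable_times) auto
  qed
  also have "\<dots> \<le> weighted_variation w f V"
    using le by (intro Liminf_le) auto
  finally show ?thesis .
qed

section \<open>The integral of the weight is an upper bound\<close>

text \<open>For \<open>r \<ge> 0\<close> the nearest-point projection onto the closed ball of radius \<open>r\<close> around the origin.\<close>

definition radial_proj :: "real \<Rightarrow> 'a::euclidean_space \<Rightarrow> 'a" where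
  "radial_proj r y = (if norm y \<le> r then y else (r / norm y) *\<^sub>R y)"

text \<open>Nearest-point projections onto convex sets are nonexpansive; through this identification the explicit
  formula inherits the property.\<close>

lemma radial_proj_eq_closest_point:
  assumes "0 \<le> r"
  shows "radial_proj r y = closest_point (cball 0 r) y"
proof (rule closest_point_unique)
  show "radial_proj r y \<in> cball 0 r"
    using assms by (auto simp: radial_proj_def)
  show "\<forall>z\<in>cball 0 r. dist y (radial_proj r y) \<le> dist y z"
  proof
    fix z :: 'a assume "z \<in> cball 0 r"
    then have z: "norm z \<le> r" by simp
    show "dist y (radial_proj r y) \<le> dist y z"
    proof (cases "norm y \<le> r")
      case False
      then have "norm y > 0" using assms by linarith
      have "y - (r / norm y) *\<^sub>R y = (1 - r / norm y) *\<^sub>R y" by (simp add: algebra_simps)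
      then have "dist y (radial_proj r y) = \<bar>1 - r / norm y\<bar> * norm y"
        using False by (simp add: radial_proj_def dist_norm)
      also have "\<dots> = norm y - r"
        using False \<open>norm y > 0\<close> by (simp add: abs_if field_simps)
      also have "\<dots> \<le> norm y - norm z" using z by simp
      also have "\<dots> \<le> dist y z" by (simp add: dist_norm norm_triangle_ineq2)
      finally show ?thesis .
    qed (simp add: radial_proj_def)
  qed
qed auto

lemma radial_proj_lipschitz:
  assumes "0 \<le> r"
  shows "dist (radial_proj r x) (radial_proj r y) \<le> dist x y"
  using closest_point_lipschitz[of "cball (0::'a::euclidean_space) r" x y] assms
  by (simp add: radial_proj_eq_closest_point)

lemma radial_proj_zero [simp]: "radial_proj r 0 = 0"
  by (simp add: radial_proj_def)

lemma norm_radial_shell_le: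
  assumes "0 \<le> r" "0 \<le> \<epsilon>"
  shows "norm (radial_proj (r + \<epsilon>) y - radial_proj r y) \<le> \<epsilon>"
proof -
  consider "norm y \<le> r" | "r < norm y" "norm y \<le> r + \<epsilon>" | "r + \<epsilon> < norm y" by linarith
  then show ?thesis
  proof cases
    case 1
    then show ?thesis using assms by (simp add: radial_proj_def)
  next
    case 2
    have "radial_proj (r + \<epsilon>) y - radial_proj r y = (1 - r / norm y) *\<^sub>R y"
      using 2 by (simp add: radial_proj_def algebra_simps)
    then have "norm (radial_proj (r + \<epsilon>) y - radial_proj r y) = \<bar>1 - r / norm y\<bar> * norm y"
      by simp
    also have "\<dots> = (1 - r / norm y) * norm y"
    proof -
      have "r / norm y \<le> 1" using 2 by (simp add: divide_le_eq)
      then show ?thesis by simp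
    qed
    also have "\<dots> = norm y - r" using 2 assms by (auto simp: left_diff_distrib)
    finally show ?thesis using 2 by simp
  next
    case 3
    have "radial_proj (r + \<epsilon>) y - radial_proj r y = (\<epsilon> / norm y) *\<^sub>R y"
      using 3 assms by (simp add: radial_proj_def add_divide_distrib algebra_simps)
    then have "norm (radial_proj (r + \<epsilon>) y - radial_proj r y) = (\<epsilon> / norm y) * norm y"
      using assms by simp
    also have "\<dots> = \<epsilon>" using 3 assms by auto
    finally show ?thesis by simp
  qed
qed

lemma test_fields_radial_proj:
  assumes "\<phi> \<in> test_fields V" "0 \<le> r"
  shows "(\<lambda>x. radial_proj r (\<phi> x)) \<in> test_fields V"
proof -
  obtain C S where S: "C-lipschitz_on UNIV \<phi>" "compact S" "S \<subseteq> V" "\<And>x. x \<notin> S \<Longrightarrow> \<phi> x = 0"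
    using assms(1) unfolding test_fields_def by blast
  have "C-lipschitz_on UNIV (\<lambda>x. radial_proj r (\<phi> x))"
  proof (rule lipschitz_onI)
    fix x y
    show "dist (radial_proj r (\<phi> x)) (radial_proj r (\<phi> y)) \<le> C * dist x y"
      using radial_proj_lipschitz[OF assms(2)] lipschitz_onD[OF S(1)] by (meson UNIV_I order_trans)
  qed (rule lipschitz_on_nonneg[OF S(1)])
  then show ?thesis by (rule test_fieldsI[OF _ S(2,3)]) (simp add: S(4))
qed

text \<open>For \<open>\<epsilon> > 0\<close> at most \<open>g x / \<epsilon> + 2\<close> indices \<open>j\<close> satisfy \<open>(j - 1) \<epsilon> < g x\<close>.  One of the two extra
  indices comes from rounding, the other from lowering each level by one step.\<close>

lemma level_count_le:
  fixes g :: "'a \<Rightarrow> real"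
  assumes "0 \<le> \<epsilon>" "0 \<le> g x"
  shows "(\<Sum>j<N. \<epsilon> * indicator {x. (real j - 1) * \<epsilon> < g x} x) \<le> g x + 2 * \<epsilon>"
proof (induction N)
  case 0
  then show ?case using assms by simp
next
  case (Suc N)
  show ?case
  proof (cases "(real N - 1) * \<epsilon> < g x")
    case True
    have "(\<Sum>j<Suc N. \<epsilon> * indicator {x. (real j - 1) * \<epsilon> < g x} x) \<le> (\<Sum>j<Suc N. \<epsilon>)"
      using assms by (intro sum_mono) (auto simp: indicator_def)
    also have "\<dots> = (real N - 1) * \<epsilon> + 2 * \<epsilon>" by (simp add: algebra_simps)
    finally show ?thesis using True by simp
  qed (use Suc.IH in simp)
qed

lemma compact_neighbourhood:
  fixes S :: "'a::euclidean_space set"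
  assumes "compact S" "open V" "S \<subseteq> V"
  obtains U where "open U" "S \<subseteq> U" "U \<Subset> V"
proof (cases "S = {}")
  case True
  show thesis by (rule that[of "{}"]) (auto simp: compactly_contained_def True)
next
  case False
  obtain e where e: "e > 0" "{x. infdist x S \<le> e} \<subseteq> V"
    using compact_in_open_separated[OF False assms] by blast
  define U where "U = {x. infdist x S < e}"
  have "open U" unfolding U_def by (intro open_Collect_less continuous_intros)
  have "S \<subseteq> U" using e(1) by (auto simp: U_def)
  have cl: "closure U \<subseteq> {x. infdist x S \<le> e}"
    by (intro closure_minimal closed_Collect_le continuous_intros) (auto simp: U_def)
  have "compact {x. infdist x S \<le> e}"
    using compact_infdist_le[OF False assms(1) e(1)] .
  then have "compact (closure U)"
    using compact_Int_closed[OF _ closed_closure, of "{x. infdist x S \<le> e}" U] cl by (simp add: Int_absorb1)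
  then show thesis
    using that[OF \<open>open U\<close> \<open>S \<subseteq> U\<close>] cl e(2) \<open>open U\<close> by (auto simp: compactly_contained_def)
qed

text \<open>The field is a telescoping sum of shells between consecutive radial projections, and the pairing with each
  shell is bounded by its height times the measure of an open set around it.  The neighbourhood \<open>U\<close> of the support is
  introduced because the error of the shell decomposition is \<open>2 \<epsilon>\<close> times the measure of \<open>U\<close>, which
  is finite by compactness, whereas \<open>V\<close> may have infinite variation.\<close>

lemma pairing_le_nn_integral_norm:
  assumes f: "locally_integrable \<Omega> f" and \<Omega>: "open \<Omega>"
    and fin: "\<And>U. U \<Subset> \<Omega> \<Longrightarrow> weighted_variation (\<lambda>_. 1) f U < \<infinity>"
    and V: "open V" "V \<subseteq> \<Omega>" and \<phi>: "\<phi> \<in> test_fields V"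
  shows "ennreal (pairing f \<phi>) \<le> (\<integral>\<^sup>+x\<in>V. ennreal (norm (\<phi> x)) \<partial>variation_measure \<Omega> f)"
proof -
  let ?\<mu> = "variation_measure \<Omega> f"
  obtain C S where S: "C-lipschitz_on UNIV \<phi>" "compact S" "S \<subseteq> V" "\<And>x. x \<notin> S \<Longrightarrow> \<phi> x = 0"
    using \<phi> unfolding test_fields_def by blast
  have cont: "continuous_on UNIV \<phi>" using S(1) by (rule lipschitz_on_continuous_on)
  obtain M where M: "M > 0" "\<And>x. norm (\<phi> x) \<le> M" using \<phi> by (metis test_fields_bounded)
  obtain U where U: "open U" "S \<subseteq> U" "U \<Subset> V"
    using compact_neighbourhood[OF S(2) V(1) S(3)] .
  have UV: "U \<subseteq> V" using U(3) closure_subset[of U] by (auto simp: compactly_contained_def)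
  have "U \<Subset> \<Omega>" using U(3) V(2) by (auto simp: compactly_contained_def)
  then have muU: "emeasure ?\<mu> U < \<infinity>"
    using fin[of U] emeasure_variation_measure_open[OF f \<Omega> U(1)] UV V(2) by auto
  have norm_meas: "(\<lambda>x. ennreal (norm (\<phi> x))) \<in> borel_measurable ?\<mu>"
  proof (rule borel_measurableI_greater)
    fix y
    have "open {x. y < ennreal (norm (\<phi> x))}"
      by (intro open_Collect_less continuous_on_ennreal continuous_intros cont)
    moreover have "{x \<in> \<Omega>. y < ennreal (norm (\<phi> x))} = \<Omega> \<inter> {x. y < ennreal (norm (\<phi> x))}" by auto
    ultimately show "{x \<in> space ?\<mu>. y < ennreal (norm (\<phi> x))} \<in> sets ?\<mu>"
      using \<Omega> by (auto simp: sets_variation_measure[OF f \<Omega>])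
  qed
  have V_sets: "V \<in> sets ?\<mu>" and U_sets: "U \<in> sets ?\<mu>"
    using U UV V by (auto simp: sets_variation_measure[OF f \<Omega>])
  have approx: "ennreal (pairing f \<phi>) \<le>
      (\<integral>\<^sup>+x\<in>V. ennreal (norm (\<phi> x)) \<partial>?\<mu>) + ennreal (2 * \<epsilon>) * emeasure ?\<mu> U" if "\<epsilon> > 0" for \<epsilon>
  proof -
    define W where "W j = U \<inter> {x. (real j - 1) * \<epsilon> < norm (\<phi> x)}" for j :: nat
    define shell where "shell j x = radial_proj (real j * \<epsilon> + \<epsilon>) (\<phi> x) - radial_proj (real j * \<epsilon>) (\<phi> x)" for j x
    have W: "open (W j)" "W j \<subseteq> U" for j
      using U(1) by (auto simp: W_def intro!: open_Int open_Collect_less continuous_intros cont)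
    have W_sets: "W j \<in> sets ?\<mu>" for j
      using W[of j] UV V(2) by (auto simp: sets_variation_measure[OF f \<Omega>])
    have W\<Omega>: "W j \<subseteq> \<Omega>" for j
      using W[of j] UV V(2) by auto
    have shell_zero: "shell j x = 0" if "norm (\<phi> x) \<le> real j * \<epsilon>" for j x
      using that \<open>\<epsilon> > 0\<close> by (auto simp: shell_def radial_proj_def)
    have shell_V: "shell j \<in> test_fields V" for j
      unfolding shell_def[abs_def]
      using test_fields_linear[OF test_fields_radial_proj[OF \<phi>, of "real j * \<epsilon> + \<epsilon>"]
          test_fields_radial_proj[OF \<phi>, of "real j * \<epsilon>"], of 1 "-1"] \<open>\<epsilon> > 0\<close> by simp
    \<comment> \<open>The shell lives on the compact set where \<open>|\<phi>| \<ge> j \<epsilon>\<close>, and lowering the level by one step gives an open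
      set around it.  For \<open>j = 0\<close> the level is negative and \<open>W j\<close> is all of \<open>U\<close>.\<close>
    have shell_W: "shell j \<in> test_fields (W j)" for j
    proof -
      obtain L where L: "L-lipschitz_on UNIV (shell j)" using shell_V unfolding test_fields_def by blast
      have "closed {x. real j * \<epsilon> \<le> norm (\<phi> x)}"
        by (intro closed_Collect_le continuous_intros cont)
      then have "compact (S \<inter> {x. real j * \<epsilon> \<le> norm (\<phi> x)})"
        using S(2) by (rule compact_Int_closed[rotated])
      moreover have "S \<inter> {x. real j * \<epsilon> \<le> norm (\<phi> x)} \<subseteq> W j"
        using U(2) \<open>\<epsilon> > 0\<close> by (auto simp: W_def algebra_simps)
      moreover have "shell j x = 0" if "x \<notin> S \<inter> {x. real j * \<epsilon> \<le> norm (\<phi> x)}" for x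
        using that S(4)[of x] \<open>\<epsilon> > 0\<close> by (intro shell_zero) (cases "x \<in> S", auto)
      ultimately show ?thesis by (rule test_fieldsI[OF L])
    qed
    have partial: "ennreal (pairing f (\<lambda>x. radial_proj (real N * \<epsilon>) (\<phi> x))) \<le>
        (\<Sum>j<N. ennreal \<epsilon> * emeasure ?\<mu> (W j))" for N
    proof (induction N)
      case 0
      have "(\<lambda>x. radial_proj (real 0 * \<epsilon>) (\<phi> x)) = (\<lambda>x. 0)"
        by (auto simp: radial_proj_def)
      then show ?case by simp
    next
      case (Suc N)
      have in_\<Omega>: "(\<lambda>x. radial_proj (real N * \<epsilon>) (\<phi> x)) \<in> test_fields \<Omega>" "shell N \<in> test_fields \<Omega>"
        using test_fields_radial_proj[OF \<phi>, of "real N * \<epsilon>"] shell_V test_fields_mono[OF V(2)] \<open>\<epsilon> > 0\<close>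
        by auto
      have "(\<lambda>x. radial_proj (real (Suc N) * \<epsilon>) (\<phi> x)) = (\<lambda>x. radial_proj (real N * \<epsilon>) (\<phi> x) + shell N x)"
        by (auto simp: shell_def algebra_simps)
      then have "pairing f (\<lambda>x. radial_proj (real (Suc N) * \<epsilon>) (\<phi> x)) =
          pairing f (\<lambda>x. radial_proj (real N * \<epsilon>) (\<phi> x)) + pairing f (shell N)"
        using pairing_add[OF f in_\<Omega>] by simp
      then have "ennreal (pairing f (\<lambda>x. radial_proj (real (Suc N) * \<epsilon>) (\<phi> x))) \<le>
          ennreal (pairing f (\<lambda>x. radial_proj (real N * \<epsilon>) (\<phi> x))) + ennreal (pairing f (shell N))"
        by (simp only: ennreal_add_le_add)
      also have "ennreal (pairing f (shell N)) \<le> ennreal \<epsilon> * emeasure ?\<mu> (W N)"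
        unfolding emeasure_variation_measure_open[OF f \<Omega> W(1) W\<Omega>]
        using norm_radial_shell_le[of "real N * \<epsilon>" \<epsilon>] \<open>\<epsilon> > 0\<close>
        by (intro pairing_le_bound[OF f W\<Omega> W(1) shell_W]) (auto simp: shell_def)
      finally show ?case using Suc.IH by (auto intro: order_trans add_mono)
    qed
    obtain N :: nat where "M / \<epsilon> < N" using reals_Archimedean2 by blast
    then have "M \<le> real N * \<epsilon>" using \<open>\<epsilon> > 0\<close> by (simp add: field_simps)
    then have "(\<lambda>x. radial_proj (real N * \<epsilon>) (\<phi> x)) = \<phi>"
      using M(2) by (auto simp: radial_proj_def fun_eq_iff intro: order_trans)
    then have "ennreal (pairing f \<phi>) \<le> (\<Sum>j<N. ennreal \<epsilon> * emeasure ?\<mu> (W j))"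
      using partial[of N] by simp
    also have "\<dots> = (\<integral>\<^sup>+x. (\<Sum>j<N. ennreal \<epsilon> * indicator (W j) x) \<partial>?\<mu>)"
      using W_sets by (subst nn_integral_sum) (auto simp: nn_integral_cmult_indicator)
    also have "\<dots> \<le> (\<integral>\<^sup>+x. ennreal (norm (\<phi> x)) * indicator V x + ennreal (2 * \<epsilon>) * indicator U x \<partial>?\<mu>)"
    proof (rule nn_integral_mono)
      fix x
      show "(\<Sum>j<N. ennreal \<epsilon> * indicator (W j) x) \<le>
          ennreal (norm (\<phi> x)) * indicator V x + ennreal (2 * \<epsilon>) * indicator U x"
      proof (cases "x \<in> U")
        case True
        have "ennreal \<epsilon> * indicator (W j) x =
            ennreal (\<epsilon> * indicator {x. (real j - 1) * \<epsilon> < norm (\<phi> x)} x)" for j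
          using True by (auto simp: W_def indicator_def)
        then have "(\<Sum>j<N. ennreal \<epsilon> * indicator (W j) x) =
            ennreal (\<Sum>j<N. \<epsilon> * indicator {x. (real j - 1) * \<epsilon> < norm (\<phi> x)} x)"
          using \<open>\<epsilon> > 0\<close> by (simp only:) (rule sum_ennreal, auto)
        also have "\<dots> \<le> ennreal (norm (\<phi> x) + 2 * \<epsilon>)"
          using level_count_le[of \<epsilon> "\<lambda>x. norm (\<phi> x)" x N] \<open>\<epsilon> > 0\<close> by (intro ennreal_leI) auto
        also have "\<dots> = ennreal (norm (\<phi> x)) * indicator V x + ennreal (2 * \<epsilon>) * indicator U x"
          using True UV \<open>\<epsilon> > 0\<close> by (auto simp: ennreal_plus)
        finally show ?thesis .
      qed (simp add: W_def)
    qed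
    also have "\<dots> = (\<integral>\<^sup>+x\<in>V. ennreal (norm (\<phi> x)) \<partial>?\<mu>) + ennreal (2 * \<epsilon>) * emeasure ?\<mu> U"
      using norm_meas V_sets U_sets by (subst nn_integral_add) (auto simp: nn_integral_cmult_indicator)
    finally show ?thesis .
  qed
  show ?thesis
  proof (rule ennreal_le_epsilon)
    fix e :: real assume "0 < e"
    obtain m where m: "0 \<le> m" "emeasure ?\<mu> U = ennreal m"
      using muU by (metis ennreal_cases infinity_ennreal_def less_irrefl)
    define \<epsilon> where "\<epsilon> = e / (2 * (m + 1))"
    have "\<epsilon> > 0" "2 * \<epsilon> * m \<le> e"
      using \<open>0 < e\<close> m(1) by (auto simp: \<epsilon>_def field_simps)
    then have "ennreal (2 * \<epsilon>) * emeasure ?\<mu> U \<le> ennreal e"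
      using m by (simp add: ennreal_mult[symmetric] ennreal_leI)
    then show "ennreal (pairing f \<phi>) \<le> (\<integral>\<^sup>+x\<in>V. ennreal (norm (\<phi> x)) \<partial>?\<mu>) + ennreal e"
      using approx[OF \<open>\<epsilon> > 0\<close>] by (meson add_left_mono order_trans)
  qed
qed

section \<open>Weighted and classical spaces of bounded variation\<close>

text \<open>A field admissible for \<open>w\<close> satisfies \<open>\<integral> |\<phi>| d\<mu> \<le> \<integral> w d\<mu>\<close>, which turns the bound for a single field into
  the upper half of the identity.\<close>

lemma weighted_variation_eq_nn_integral:
  assumes f: "locally_integrable \<Omega> f" and \<Omega>: "open \<Omega>"
    and fin: "\<And>U. U \<Subset> \<Omega> \<Longrightarrow> weighted_variation (\<lambda>_. 1) f U < \<infinity>"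
    and V: "open V" "V \<subseteq> \<Omega>" and lsc: "lower_semicontinuous w"
  shows "weighted_variation w f V = (\<integral>\<^sup>+x\<in>V. w x \<partial>variation_measure \<Omega> f)"
proof (rule antisym)
  show "weighted_variation w f V \<le> (\<integral>\<^sup>+x\<in>V. w x \<partial>variation_measure \<Omega> f)"
  proof (rule weighted_variation_least[OF V(1)])
    fix \<phi> assume "\<phi> \<in> admissible w V"
    then have \<phi>: "\<phi> \<in> test_fields V" "\<And>x. ennreal (norm (\<phi> x)) \<le> w x"
      by (auto simp: admissible_def)
    have "ennreal (pairing f \<phi>) \<le> (\<integral>\<^sup>+x\<in>V. ennreal (norm (\<phi> x)) \<partial>variation_measure \<Omega> f)"
      by (rule pairing_le_nn_integral_norm[OF f \<Omega> fin V \<phi>(1)])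
    also have "\<dots> \<le> (\<integral>\<^sup>+x\<in>V. w x \<partial>variation_measure \<Omega> f)"
      by (intro nn_integral_mono mult_right_mono \<phi>(2)) auto
    finally show "ennreal (pairing f \<phi>) \<le> (\<integral>\<^sup>+x\<in>V. w x \<partial>variation_measure \<Omega> f)" .
  qed
  show "(\<integral>\<^sup>+x\<in>V. w x \<partial>variation_measure \<Omega> f) \<le> weighted_variation w f V"
    by (rule nn_integral_le_weighted_variation[OF f \<Omega> V lsc])
qed

text \<open>The superlevel sets \<open>{w > 1 / n}\<close> increase and form an open cover, so one of them contains the compact
  set.\<close>

lemma lsc_positive_lower_bound_on_compact:
  fixes w :: "'a::euclidean_space \<Rightarrow> ennreal"
  assumes lsc: "lower_semicontinuous w" and pos: "\<And>x. 0 < w x" and K: "compact K"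
  obtains c :: real where "0 < c" "\<And>x. x \<in> K \<Longrightarrow> ennreal c \<le> w x"
proof -
  define U where "U n = {x. ennreal (1 / real (Suc n)) < w x}" for n
  have "x \<in> (\<Union>n. U n)" for x
  proof -
    obtain y where y: "0 < y" "y < w x" using dense[OF pos[of x]] by blast
    then obtain r where r: "0 < r" "y = ennreal r"
      by (cases y) auto
    obtain n where "1 / real (Suc n) < r" using nat_approx_posE[OF r(1)] by blast
    then have "ennreal (1 / real (Suc n)) \<le> y" using r by (simp add: ennreal_leI)
    then have "x \<in> U n" using y(2) unfolding U_def by (simp only: mem_Collect_eq order_le_less_trans)
    then show ?thesis by blast
  qed
  then have cover: "K \<subseteq> (\<Union>n\<in>UNIV. U n)" by blast
  obtain I where I: "finite I" "K \<subseteq> (\<Union>n\<in>I. U n)"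
    using compactE_image[OF K _ cover] open_superlevel_lsc[OF lsc] unfolding U_def by metis
  obtain N where N: "I \<subseteq> {..<N}" using finite_nat_bounded[OF I(1)] by blast
  have "ennreal (1 / real (Suc N)) \<le> w x" if xK: "x \<in> K" for x
  proof -
    obtain n where n: "n < N" "ennreal (1 / real (Suc n)) < w x"
      using I(2) N xK unfolding U_def by blast
    have "1 / real (Suc N) \<le> 1 / real (Suc n)" using n(1) by (simp add: frac_le)
    then show ?thesis using n(2) by (meson ennreal_leI less_imp_le order_trans)
  qed
  then show thesis by (intro that[of "1 / real (Suc N)"]) auto
qed

lemma measurable_on_subset:
  fixes f :: "'a::euclidean_space \<Rightarrow> real"
  assumes f: "f \<in> borel_measurable (lebesgue_on \<Omega>)" and \<Omega>: "open \<Omega>" and K: "K \<in> sets lebesgue" "K \<subseteq> \<Omega>"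
  shows "(\<lambda>x. indicator K x *\<^sub>R f x) \<in> borel_measurable lebesgue"
proof -
  have "\<Omega> \<in> sets lebesgue" using \<Omega> by auto
  then have "(\<lambda>x. indicator \<Omega> x *\<^sub>R f x) \<in> borel_measurable lebesgue"
    using f by (simp add: borel_measurable_restrict_space_iff)
  from borel_measurable_scaleR[OF borel_measurable_indicator[OF K(1)] this]
  have "(\<lambda>x. indicator K x *\<^sub>R (indicator \<Omega> x *\<^sub>R f x)) \<in> borel_measurable lebesgue" .
  moreover have "(\<lambda>x. indicator K x *\<^sub>R (indicator \<Omega> x *\<^sub>R f x)) = (\<lambda>x. indicator K x *\<^sub>R f x)"
    using K(2) by (auto simp: indicator_def fun_eq_iff)
  ultimately show ?thesis by (simp only:)
qed

lemma L1_loc_imp_locally_integrable: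
  fixes f :: "'a::euclidean_space \<Rightarrow> real"
  assumes f: "f \<in> L1_loc_weighted \<Omega> (\<lambda>_. 1)" and \<Omega>: "open \<Omega>"
  shows "locally_integrable \<Omega> f"
  unfolding locally_integrable_def
proof (intro allI impI)
  fix K assume K: "compact K \<and> K \<subseteq> \<Omega>"
  have m: "f \<in> borel_measurable (lebesgue_on \<Omega>)"
    and fin: "(\<integral>\<^sup>+x\<in>K. ennreal \<bar>f x\<bar> * 1 \<partial>lebesgue) < \<infinity>"
    using f K by (auto simp: L1_loc_weighted_def)
  have "K \<in> sets lebesgue" using K by (metis borel_compact lborelD sets_completionI_sets)
  then have meas: "(\<lambda>x. indicator K x *\<^sub>R f x) \<in> borel_measurable lebesgue"
    using measurable_on_subset[OF m \<Omega>] K by blast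
  have "(\<integral>\<^sup>+x. ennreal (norm (indicator K x *\<^sub>R f x)) \<partial>lebesgue) = (\<integral>\<^sup>+x\<in>K. ennreal \<bar>f x\<bar> * 1 \<partial>lebesgue)"
    by (intro nn_integral_cong) (auto simp: indicator_def)
  with fin meas show "set_integrable lebesgue K f"
    unfolding set_integrable_def by (intro integrableI_bounded) auto
qed

text \<open>The constant is moved inside the integral of \<open>|f|\<close>, which is measurable, before the integrands are
  compared pointwise.\<close>

lemma weighted_integral_lower_bound:
  fixes f :: "'a::euclidean_space \<Rightarrow> real"
  assumes f: "f \<in> borel_measurable (lebesgue_on \<Omega>)" and \<Omega>: "open \<Omega>" and K: "K \<in> sets lebesgue" "K \<subseteq> \<Omega>"
    and c: "\<And>x. x \<in> K \<Longrightarrow> ennreal c \<le> w x"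
  shows "ennreal c * (\<integral>\<^sup>+x\<in>K. ennreal \<bar>f x\<bar> * 1 \<partial>lebesgue) \<le> (\<integral>\<^sup>+x\<in>K. ennreal \<bar>f x\<bar> * w x \<partial>lebesgue)"
proof -
  have "(\<lambda>x. ennreal (norm (indicator K x *\<^sub>R f x))) \<in> borel_measurable lebesgue"
    using measurable_on_subset[OF f \<Omega> K] by measurable
  moreover have "(\<lambda>x. ennreal (norm (indicator K x *\<^sub>R f x))) = (\<lambda>x. ennreal \<bar>f x\<bar> * 1 * indicator K x)"
    by (auto simp: indicator_def fun_eq_iff)
  ultimately have "(\<lambda>x. ennreal \<bar>f x\<bar> * 1 * indicator K x) \<in> borel_measurable lebesgue"
    by (simp only:)
  from nn_integral_cmult[OF this, of "ennreal c"]
  have "ennreal c * (\<integral>\<^sup>+x\<in>K. ennreal \<bar>f x\<bar> * 1 \<partial>lebesgue) =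
      (\<integral>\<^sup>+x. ennreal c * (ennreal \<bar>f x\<bar> * 1 * indicator K x) \<partial>lebesgue)" by (rule sym)
  also have "\<dots> \<le> (\<integral>\<^sup>+x\<in>K. ennreal \<bar>f x\<bar> * w x \<partial>lebesgue)"
  proof (rule nn_integral_mono)
    fix x
    show "ennreal c * (ennreal \<bar>f x\<bar> * 1 * indicator K x) \<le> ennreal \<bar>f x\<bar> * w x * indicator K x"
    proof (cases "x \<in> K")
      case True
      have "ennreal \<bar>f x\<bar> * ennreal c \<le> ennreal \<bar>f x\<bar> * w x" using c[OF True] by (rule mult_left_mono) simp
      then show ?thesis using True by (simp add: mult.commute)
    qed simp
  qed
  finally show ?thesis .
qed

lemma ennreal_finite_if_scaled_finite:
  assumes "ennreal c * a \<le> b" "b < \<infinity>" "0 < c"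
  shows "a < \<infinity>"
proof -
  have "ennreal c * a < top" using assms(1,2) by (metis infinity_ennreal_def le_less_trans)
  moreover have "ennreal c \<noteq> 0" using assms(3) by simp
  ultimately show ?thesis by (auto simp: ennreal_mult_less_top)
qed

lemma L1_loc_weighted_imp_L1_loc:
  assumes lsc: "lower_semicontinuous w" and pos: "\<And>x. 0 < w x" and \<Omega>: "open \<Omega>"
    and f: "f \<in> L1_loc_weighted \<Omega> w"
  shows "f \<in> L1_loc_weighted \<Omega> (\<lambda>_. 1)"
proof -
  have m: "f \<in> borel_measurable (lebesgue_on \<Omega>)" using f by (simp add: L1_loc_weighted_def)
  have "(\<integral>\<^sup>+x\<in>K. ennreal \<bar>f x\<bar> * 1 \<partial>lebesgue) < \<infinity>" if K: "compact K" "K \<subseteq> \<Omega>" for K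
  proof -
    obtain c where c: "0 < c" "\<And>x. x \<in> K \<Longrightarrow> ennreal c \<le> w x"
      using lsc_positive_lower_bound_on_compact[OF lsc pos K(1)] by blast
    have Ks: "K \<in> sets lebesgue" using K(1) by (metis borel_compact lborelD sets_completionI_sets)
    have fin: "(\<integral>\<^sup>+x\<in>K. ennreal \<bar>f x\<bar> * w x \<partial>lebesgue) < \<infinity>"
      using f K by (simp add: L1_loc_weighted_def)
    show ?thesis
      by (rule ennreal_finite_if_scaled_finite[OF weighted_integral_lower_bound[OF m \<Omega> Ks K(2) c(2)] fin c(1)])
  qed
  then show ?thesis using m by (simp add: L1_loc_weighted_def)
qed

lemma L1_weighted_imp_L1_loc_weighted:
  assumes "f \<in> L1_weighted \<Omega> w"
  shows "f \<in> L1_loc_weighted \<Omega> w"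
proof -
  have "(\<integral>\<^sup>+x\<in>K. ennreal \<bar>f x\<bar> * w x \<partial>lebesgue) \<le> (\<integral>\<^sup>+x\<in>\<Omega>. ennreal \<bar>f x\<bar> * w x \<partial>lebesgue)"
    if "K \<subseteq> \<Omega>" for K
    using that by (intro nn_integral_mono) (auto simp: indicator_def)
  then show ?thesis
    using assms unfolding L1_weighted_def L1_loc_weighted_def by (auto intro: le_less_trans)
qed

lemma weighted_variation_lower_bound:
  assumes f: "locally_integrable \<Omega> f" and V: "open V" "V \<subseteq> \<Omega>" and c: "0 \<le> c" "\<And>x. x \<in> V \<Longrightarrow> ennreal c \<le> w x"
  shows "ennreal c * weighted_variation (\<lambda>_. 1) f V \<le> weighted_variation w f V"
proof -
  have "ennreal c * weighted_variation (\<lambda>_. 1) f V \<le> weighted_variation (\<lambda>x. ennreal c * indicator V x) f V"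
    by (rule weighted_variation_step_weight[OF f V(2) V(1) V(1) order_refl c(1)])
  also have "\<dots> \<le> weighted_variation w f V"
    using c(2) by (intro weighted_variation_mono V) auto
  finally show ?thesis .
qed

text \<open>On a compactly contained set \<open>w\<close> has a positive lower bound \<open>c\<close>, and the weighted integral and variation
  dominate \<open>c\<close> times the classical ones.\<close>

lemma BV_loc_weighted_imp_BV_loc:
  assumes lsc: "lower_semicontinuous w" and pos: "\<And>x. 0 < w x" and \<Omega>: "open \<Omega>"
    and f: "f \<in> BV_loc_weighted \<Omega> w"
  shows "f \<in> BV_loc \<Omega>"
proof -
  have L1: "f \<in> L1_loc_weighted \<Omega> (\<lambda>_. 1)"
    using f by (intro L1_loc_weighted_imp_L1_loc[OF lsc pos \<Omega>]) (simp add: BV_loc_weighted_def)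
  have "weighted_variation (\<lambda>_. 1) f V < \<infinity>" if "V \<Subset> \<Omega>" for V
  proof -
    have V: "open V" "compact (closure V)" "V \<subseteq> \<Omega>"
      using that closure_subset[of V] by (auto simp: compactly_contained_def)
    obtain c where c: "0 < c" "\<And>x. x \<in> closure V \<Longrightarrow> ennreal c \<le> w x"
      using lsc_positive_lower_bound_on_compact[OF lsc pos V(2)] by blast
    have "ennreal c * weighted_variation (\<lambda>_. 1) f V \<le> weighted_variation w f V"
      using c closure_subset[of V]
      by (intro weighted_variation_lower_bound[OF L1_loc_imp_locally_integrable[OF L1 \<Omega>] V(1,3)]) auto
    moreover have "weighted_variation w f V < \<infinity>"
      using f that by (simp add: BV_loc_weighted_def)
    ultimately show ?thesis using c(1) by (rule ennreal_finite_if_scaled_finite)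
  qed
  then show ?thesis using L1 by (simp add: BV_loc_weighted_def)
qed

lemma BV_weighted_imp_BV_loc_weighted:
  assumes "open \<Omega>" "f \<in> BV_weighted \<Omega> w"
  shows "f \<in> BV_loc_weighted \<Omega> w"
proof -
  have "weighted_variation w f V < \<infinity>" if "V \<Subset> \<Omega>" for V
  proof -
    have "weighted_variation w f V \<le> weighted_variation w f \<Omega>"
      using that closure_subset[of V] assms(1)
      by (intro weighted_variation_mono) (auto simp: compactly_contained_def)
    also have "\<dots> < \<infinity>" using assms(2) by (simp add: BV_weighted_def)
    finally show ?thesis .
  qed
  then show ?thesis
    using assms(2) by (auto simp: BV_loc_weighted_def BV_weighted_def intro: L1_weighted_imp_L1_loc_weighted)
qed

theorem theorem3p1:
  fixes \<Omega> :: "'a::euclidean_space set" and w :: "'a \<Rightarrow> ennreal" and f :: "'a \<Rightarrow> real"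
  assumes "open \<Omega>" and "lower_semicontinuous w" and "\<And>x. 0 < w x"
  shows
    "((f \<in> L1_weighted \<Omega> w \<longrightarrow>
         (f \<in> BV_weighted \<Omega> w \<longleftrightarrow>
            f \<in> BV_loc \<Omega> \<and> w \<in> L1_measure \<Omega> (variation_measure \<Omega> f))) \<and>
      (f \<in> BV_loc \<Omega> \<and> w \<in> L1_measure \<Omega> (variation_measure \<Omega> f) \<longrightarrow>
         weighted_variation w f \<Omega> = (\<integral>\<^sup>+x\<in>\<Omega>. w x \<partial>variation_measure \<Omega> f)))
     \<and>
     ((f \<in> L1_loc_weighted \<Omega> w \<longrightarrow>
         (f \<in> BV_loc_weighted \<Omega> w \<longleftrightarrow>
            f \<in> BV_loc \<Omega> \<and> w \<in> L1_loc_measure \<Omega> (variation_measure \<Omega> f))) \<and>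
      (f \<in> BV_loc \<Omega> \<and> w \<in> L1_loc_measure \<Omega> (variation_measure \<Omega> f) \<longrightarrow>
         (\<forall>V. V \<Subset> \<Omega> \<longrightarrow>
            weighted_variation w f V = (\<integral>\<^sup>+x\<in>V. w x \<partial>variation_measure \<Omega> f))))
     \<and>
     (\<forall>c::real. 0 < c \<and> (\<forall>x\<in>\<Omega>. ennreal c \<le> w x) \<longrightarrow>
        (f \<in> L1_weighted \<Omega> w \<longrightarrow>
           (f \<in> BV_weighted \<Omega> w \<longleftrightarrow>
              f \<in> BV \<Omega> \<and> w \<in> L1_measure \<Omega> (variation_measure \<Omega> f))) \<and>
        (f \<in> BV \<Omega> \<and> w \<in> L1_measure \<Omega> (variation_measure \<Omega> f) \<longrightarrow>
           weighted_variation w f \<Omega> = (\<integral>\<^sup>+x\<in>\<Omega>. w x \<partial>variation_measure \<Omega> f)))"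
proof -
  note \<Omega> = assms(1) and lsc = assms(2) and pos = assms(3)
  let ?\<mu> = "variation_measure \<Omega> f"
  have loc: "locally_integrable \<Omega> f" if "f \<in> BV_loc \<Omega>"
    using that by (intro L1_loc_imp_locally_integrable \<Omega>) (simp add: BV_loc_weighted_def)
  have eq: "weighted_variation w f V = (\<integral>\<^sup>+x\<in>V. w x \<partial>?\<mu>)"
    if BV: "f \<in> BV_loc \<Omega>" and "open V" "V \<subseteq> \<Omega>" for V
    using BV by (intro weighted_variation_eq_nn_integral[OF loc[OF BV] \<Omega> _ that(2,3) lsc])
      (simp add: BV_loc_weighted_def)
  have meas: "w \<in> borel_measurable ?\<mu>" if BV: "f \<in> BV_loc \<Omega>"
    by (rule measurable_variation_measure_lsc[OF loc[OF BV] \<Omega> lsc])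
  have BV_loc: "f \<in> BV_loc \<Omega>" if "f \<in> BV_weighted \<Omega> w"
    by (intro BV_loc_weighted_imp_BV_loc[OF lsc pos \<Omega>] BV_weighted_imp_BV_loc_weighted[OF \<Omega>] that)
  have i: "f \<in> BV_weighted \<Omega> w \<longleftrightarrow> f \<in> BV_loc \<Omega> \<and> w \<in> L1_measure \<Omega> ?\<mu>"
    if "f \<in> L1_weighted \<Omega> w"
    using that BV_loc eq[OF _ \<Omega> order_refl] meas by (auto simp: BV_weighted_def L1_measure_def)
  have sub: "V \<subseteq> \<Omega>" "open V" "compact (closure V)" "closure V \<subseteq> \<Omega>" if "V \<Subset> \<Omega>" for V
    using that closure_subset[of V] by (auto simp: compactly_contained_def)
  have ii: "f \<in> BV_loc_weighted \<Omega> w \<longleftrightarrow> f \<in> BV_loc \<Omega> \<and> w \<in> L1_loc_measure \<Omega> ?\<mu>"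
    if L1: "f \<in> L1_loc_weighted \<Omega> w"
  proof
    assume f: "f \<in> BV_loc_weighted \<Omega> w"
    then have BV: "f \<in> BV_loc \<Omega>" by (rule BV_loc_weighted_imp_BV_loc[OF lsc pos \<Omega>])
    have "(\<integral>\<^sup>+x\<in>K. w x \<partial>?\<mu>) < \<infinity>" if K: "compact K" "K \<subseteq> \<Omega>" for K
    proof -
      obtain U where U: "open U" "K \<subseteq> U" "U \<Subset> \<Omega>" by (rule compact_neighbourhood[OF K(1) \<Omega> K(2)])
      have "(\<integral>\<^sup>+x\<in>K. w x \<partial>?\<mu>) \<le> (\<integral>\<^sup>+x\<in>U. w x \<partial>?\<mu>)"
        using U(2) by (intro nn_integral_mono) (auto simp: indicator_def)
      also have "\<dots> = weighted_variation w f U"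
        using eq[OF BV U(1) sub(1)[OF U(3)]] by simp
      also have "\<dots> < \<infinity>" using f U(3) by (simp add: BV_loc_weighted_def)
      finally show ?thesis .
    qed
    then show "f \<in> BV_loc \<Omega> \<and> w \<in> L1_loc_measure \<Omega> ?\<mu>"
      using BV meas[OF BV] by (simp add: L1_loc_measure_def)
  next
    assume *: "f \<in> BV_loc \<Omega> \<and> w \<in> L1_loc_measure \<Omega> ?\<mu>"
    have "weighted_variation w f V < \<infinity>" if V: "V \<Subset> \<Omega>" for V
    proof -
      have "weighted_variation w f V = (\<integral>\<^sup>+x\<in>V. w x \<partial>?\<mu>)"
        using * eq[OF _ sub(2,1)[OF V]] by simp
      also have "\<dots> \<le> (\<integral>\<^sup>+x\<in>closure V. w x \<partial>?\<mu>)"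
        using closure_subset[of V] by (intro nn_integral_mono) (auto simp: indicator_def)
      also have "\<dots> < \<infinity>" using * sub(3,4)[OF V] by (simp add: L1_loc_measure_def)
      finally show ?thesis .
    qed
    then show "f \<in> BV_loc_weighted \<Omega> w" using L1 by (simp add: BV_loc_weighted_def)
  qed
  have BV_imp: "f \<in> BV_loc \<Omega>" if "f \<in> BV \<Omega>"
    using \<Omega> that by (rule BV_weighted_imp_BV_loc_weighted)
  have iii: "f \<in> BV \<Omega>"
    if c: "0 < c" "\<forall>x\<in>\<Omega>. ennreal c \<le> w x" and f: "f \<in> BV_weighted \<Omega> w" for c :: real
  proof -
    have fin: "(\<integral>\<^sup>+x\<in>\<Omega>. ennreal \<bar>f x\<bar> * w x \<partial>lebesgue) < \<infinity>" "weighted_variation w f \<Omega> < \<infinity>"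
      and m: "f \<in> borel_measurable (lebesgue_on \<Omega>)"
      using f by (auto simp: BV_weighted_def L1_weighted_def)
    have \<Omega>s: "\<Omega> \<in> sets lebesgue" using \<Omega> by auto
    have c': "\<And>x. x \<in> \<Omega> \<Longrightarrow> ennreal c \<le> w x" using c(2) by blast
    have "(\<integral>\<^sup>+x\<in>\<Omega>. ennreal \<bar>f x\<bar> * 1 \<partial>lebesgue) < \<infinity>"
      by (rule ennreal_finite_if_scaled_finite[OF
            weighted_integral_lower_bound[OF m \<Omega> \<Omega>s order_refl c'] fin(1) c(1)])
    moreover have "weighted_variation (\<lambda>_. 1) f \<Omega> < \<infinity>"
      using c(1) by (intro ennreal_finite_if_scaled_finite[OF
            weighted_variation_lower_bound[OF loc[OF BV_loc[OF f]] \<Omega> order_refl _ c'] fin(2) c(1)]) simp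
    ultimately show ?thesis using m by (simp add: BV_weighted_def L1_weighted_def)
  qed
  show ?thesis
  proof (intro conjI impI allI)
    fix c :: real
    assume c: "0 < c \<and> (\<forall>x\<in>\<Omega>. ennreal c \<le> w x)" and L1: "f \<in> L1_weighted \<Omega> w"
    show "f \<in> BV_weighted \<Omega> w \<longleftrightarrow> f \<in> BV \<Omega> \<and> w \<in> L1_measure \<Omega> ?\<mu>"
      using i[OF L1] iii c BV_imp by blast
  qed (use i ii eq \<Omega> sub BV_imp in blast)+
qed

end
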